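(* Let $X$ be a metric space. Fix $k\ge 0$ and $n=2k+2$. The cost of approximating $D^{\mathrm{VR}}_{2k+2,k}(X)$ with $N$ samples is $O(n^2\cdot N)$; that is, given the $n\times n$ distance matrices of $N$ samples of $n$ points from $X$, all $N$ persistence diagrams in degree $k$ of these samples can be computed with $O(n^2 N)$ elementary operations.
   Context: For a finite metric space $Y$ and $r\ge 0$, $\mathrm{VR}_r(Y)$ is the simplicial complex of nonempty subsets $\sigma\subset Y$ with $\mathrm{diam}(\sigma)\le r$. With a fixed coefficient field $\mathbb F$, the persistence module $r\mapsto\widetilde H_k(\mathrm{VR}_r(Y);\mathbb F)$ decomposes into finitely many interval modules on intervals $[b_\alpha,d_\alpha)$, and $\mathrm{dgm}_k^{\mathrm{VR}}(Y)$ is the multiset of points $(b_\alpha,d_\alpha)$. For a tuple of points with repetitions, the diagram is that of the underlying set of distinct points. The principal persistence set is $D^{\mathrm{VR}}_{2k+2,k}(X)=\{\mathrm{dgm}_k^{\mathrm{VR}}(X'):X'\subset X,\ |X'|\le 2k+2\}$. Approximating it with $N$ samples means choosing $N$ $n$-tuples of points of $X$ and computing the degree $k$ Vietoris-Rips persistence diagram of each one. Elementary operations are comparisons/look-ups of distance matrix entries. *)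

theory Defs
  imports
    "HOL-Analysis.Abstract_Metric_Spaces"
    "HOL-Library.Multiset"
    "HOL-Library.Function_Algebras"
    "HOL-Library.Set_Algebras"
begin

section \<open>Vietoris--Rips complexes\<close>

definition diam :: "('a \<Rightarrow> 'a \<Rightarrow> real) \<Rightarrow> 'a set \<Rightarrow> real" where
  "diam d \<sigma> = Max {d x y | x y. x \<in> \<sigma> \<and> y \<in> \<sigma>}"

definition VR :: "'a set \<Rightarrow> ('a \<Rightarrow> 'a \<Rightarrow> real) \<Rightarrow> real \<Rightarrow> 'a set set" where
  "VR Y d r = {\<sigma>. \<sigma> \<noteq> {} \<and> \<sigma> \<subseteq> Y \<and> diam d \<sigma> \<le> r}"

section \<open>Reduced simplicial homology with coefficients in a field\<close>

text \<open>
  A simplicial complex \<open>K\<close> is a set of nonempty finite simplices.  A \<open>p\<close>-chain is a function on the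
  oriented \<open>p\<close>-simplices that changes sign with the orientation.  An oriented \<open>p\<close>-simplex is
  represented by the lists of its \<open>p + 1\<close> vertices; odd permutations reverse the orientation, and
  the sign rule is required for adjacent transpositions only, since these generate all permutations.
  Chains are graded by the number \<open>m = p + 1\<close> of vertices, so that \<open>m = 0\<close> (the empty list) is the
  degree \<open>-1\<close> part of the augmented complex.
\<close>

definition chains :: "'a set set \<Rightarrow> nat \<Rightarrow> ('a list \<Rightarrow> 'f::field) set" where
  "chains K m = {c.
     (\<forall>xs. c xs \<noteq> 0 \<longrightarrow> length xs = m \<and> distinct xs \<and> (xs = [] \<or> set xs \<in> K)) \<and>
     (\<forall>us a b vs. c (us @ [a, b] @ vs) = - c (us @ [b, a] @ vs))}"

text \<open>
  This is the linear extension of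
  \<open>[v\<^sub>0, \<dots>, v\<^sub>p] \<mapsto> \<Sum>i. (-1)\<^sup>i [v\<^sub>0, \<dots>, v\<^sub>i omitted, \<dots>, v\<^sub>p]\<close>: moving \<open>v\<^sub>i\<close> to the front costs the sign
  \<open>(-1)\<^sup>i\<close>, so the coefficient of \<open>\<partial>c\<close> at \<open>[y\<^sub>1, \<dots>, y\<^sub>p]\<close> is the sum over all vertices \<open>v\<close> of the coefficient
  of \<open>c\<close> at \<open>[v, y\<^sub>1, \<dots>, y\<^sub>p]\<close>.  For \<open>p = 0\<close> it is the augmentation.
\<close>

definition boundary :: "'a set set \<Rightarrow> ('a list \<Rightarrow> 'f::field) \<Rightarrow> ('a list \<Rightarrow> 'f)" where
  "boundary K c = (\<lambda>ys. \<Sum>v\<in>\<Union>K. c (v # ys))"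

definition cycles :: "'a set set \<Rightarrow> nat \<Rightarrow> ('a list \<Rightarrow> 'f::field) set" where
  "cycles K k = {z \<in> chains K (k + 1). boundary K z = 0}"

definition boundaries :: "'a set set \<Rightarrow> nat \<Rightarrow> ('a list \<Rightarrow> 'f::field) set" where
  "boundaries K k = boundary K ` chains K (k + 2)"

section \<open>Persistence modules indexed by the nonnegative reals\<close>

text \<open>\<open>map_at M r s\<close> is the structure map from parameter \<open>r\<close> to parameter \<open>s\<close>, for \<open>0 \<le> r \<le> s\<close>.\<close>

record ('f, 'v) persistence_module =
  space_at :: "real \<Rightarrow> 'v set"
  plus_at :: "real \<Rightarrow> 'v \<Rightarrow> 'v \<Rightarrow> 'v"
  scale_at :: "real \<Rightarrow> 'f \<Rightarrow> 'v \<Rightarrow> 'v"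
  map_at :: "real \<Rightarrow> real \<Rightarrow> 'v \<Rightarrow> 'v"

definition persistence_iso ::
    "('f, 'v) persistence_module \<Rightarrow> ('f, 'w) persistence_module \<Rightarrow> bool" where
  "persistence_iso M N \<longleftrightarrow> (\<exists>\<phi>.
     (\<forall>r\<ge>0. bij_betw (\<phi> r) (space_at M r) (space_at N r)) \<and>
     (\<forall>r\<ge>0. \<forall>x\<in>space_at M r. \<forall>y\<in>space_at M r.
        \<phi> r (plus_at M r x y) = plus_at N r (\<phi> r x) (\<phi> r y)) \<and>
     (\<forall>r\<ge>0. \<forall>a. \<forall>x\<in>space_at M r. \<phi> r (scale_at M r a x) = scale_at N r a (\<phi> r x)) \<and>
     (\<forall>r\<ge>0. \<forall>s\<ge>r. \<forall>x\<in>space_at M r. \<phi> s (map_at M r s x) = map_at N r s (\<phi> r x)))"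

text \<open>
  The reduced homology of the Vietoris--Rips filtration in degree \<open>k\<close>.  Homology classes are cosets
  \<open>z + B\<close> of the space \<open>B\<close> of boundaries.  The map induced by \<open>VR\<^sub>r \<subseteq> VR\<^sub>s\<close> sends \<open>z + B\<^sub>r\<close> to
  \<open>z + B\<^sub>s\<close>, which is the sum of the sets \<open>z + B\<^sub>r\<close> and \<open>B\<^sub>s\<close>; likewise \<open>a\<cdot>(z + B) = a\<cdot>z + B\<close>
  is written as a sum of sets, which is also correct for \<open>a = 0\<close>.
\<close>

definition VR_homology ::
    "nat \<Rightarrow> 'a set \<Rightarrow> ('a \<Rightarrow> 'a \<Rightarrow> real) \<Rightarrow> ('f::field, ('a list \<Rightarrow> 'f) set) persistence_module" where
  "VR_homology k Y d = \<lparr>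
     space_at = (\<lambda>r. {z +o boundaries (VR Y d r) k | z. z \<in> cycles (VR Y d r) k}),
     plus_at = (\<lambda>r U V. U + V),
     scale_at = (\<lambda>r a U. (\<lambda>z xs. a * z xs) ` U + boundaries (VR Y d r) k),
     map_at = (\<lambda>r s U. U + boundaries (VR Y d s) k) \<rparr>"

text \<open>
  The direct sum of the interval modules on \<open>[b, d)\<close> over the points \<open>(b, d)\<close> of a finite multiset
  \<open>D\<close>.  The summands are indexed by pairs \<open>(p, i)\<close> with \<open>i < count D p\<close>, that is, by the points
  repeated according to their multiplicity.
\<close>

definition interval_sum ::
    "(real \<times> real) multiset \<Rightarrow>
      ('f::field, (real \<times> real) \<times> nat \<Rightarrow> 'f) persistence_module" where
  "interval_sum D = \<lparr>
     space_at = (\<lambda>r. {f. \<forall>p i. f (p, i) \<noteq> 0 \<longrightarrow> i < count D p \<and> r \<in> {fst p..<snd p}}),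
     plus_at = (\<lambda>r f g. f + g),
     scale_at = (\<lambda>r a f. (\<lambda>x. a * f x)),
     map_at = (\<lambda>r s f. (\<lambda>(p, i). if s \<in> {fst p..<snd p} then f (p, i) else 0)) \<rparr>"

text \<open>
  \<open>is_dgm_VR TYPE('f) k Y d D\<close>: \<open>D\<close> is the degree \<open>k\<close> persistence diagram of the finite metric space
  \<open>(Y, d)\<close> over the field \<open>'f\<close>.  No infinite death times are needed: \<open>VR Y d r\<close> is the full simplex
  for large \<open>r\<close>, so its reduced homology vanishes in degrees \<open>k \<ge> 0\<close>.
\<close>

definition is_dgm_VR ::
    "'f::field itself \<Rightarrow> nat \<Rightarrow> 'a set \<Rightarrow> ('a \<Rightarrow> 'a \<Rightarrow> real) \<Rightarrow> (real \<times> real) multiset \<Rightarrow> bool" where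
  "is_dgm_VR F k Y d D \<longleftrightarrow>
     (\<forall>(b, e)\<in>#D. 0 \<le> b \<and> b < e) \<and>
     persistence_iso
       (VR_homology k Y d :: ('f, ('a list \<Rightarrow> 'f) set) persistence_module)
       (interval_sum D :: ('f, (real \<times> real) \<times> nat \<Rightarrow> 'f) persistence_module)"

definition persistence_set ::
    "'f::field itself \<Rightarrow> nat \<Rightarrow> nat \<Rightarrow> 'a set \<Rightarrow> ('a \<Rightarrow> 'a \<Rightarrow> real) \<Rightarrow> (real \<times> real) multiset set" where
  "persistence_set F n k X d =
     {D. \<exists>X'. X' \<subseteq> X \<and> finite X' \<and> card X' \<le> n \<and> is_dgm_VR F k X' d D}"

definition principal_persistence_set ::
    "'f::field itself \<Rightarrow> nat \<Rightarrow> 'a set \<Rightarrow> ('a \<Rightarrow> 'a \<Rightarrow> real) \<Rightarrow> (real \<times> real) multiset set" where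
  "principal_persistence_set F k X d = persistence_set F (2 * k + 2) k X d"

section \<open>Algorithms on distance matrices\<close>

text \<open>
  A small random access machine with index registers (natural numbers) and distance registers
  (reals).  Distances are opaque: they can be looked up in the input matrices, copied, compared and
  output, but there is no arithmetic on them, and they influence the rest of the computation
  only through comparisons.  The input is \<open>A s i j\<close>, entry \<open>(i, j)\<close> of the matrix of sample \<open>s\<close>.
\<close>

datatype index_expr = Num nat | Reg nat | Add index_expr index_expr

datatype test =
    IndexLess index_expr index_expr
  | DistLess nat nat

datatype program =
    Skip
  | SetIndex nat index_expr
  | LookUp nat index_expr index_expr index_expr \<comment> \<open>target register, sample, row, column\<close>
  | Copy nat nat \<comment> \<open>target register, source register\<close>
  | Emit index_expr nat nat \<comment> \<open>add a (birth, death) point to the diagram of a sample\<close>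
  | Seq program program
  | Cond test program program
  | Loop test program

record machine =
  index :: "nat \<Rightarrow> nat"
  dist_reg :: "nat \<Rightarrow> real"
  diagrams :: "nat \<Rightarrow> (real \<times> real) multiset"

fun eval_index :: "index_expr \<Rightarrow> machine \<Rightarrow> nat" where
  "eval_index (Num c) \<sigma> = c"
| "eval_index (Reg i) \<sigma> = index \<sigma> i"
| "eval_index (Add e e') \<sigma> = eval_index e \<sigma> + eval_index e' \<sigma>"

fun eval_test :: "test \<Rightarrow> machine \<Rightarrow> bool" where
  "eval_test (IndexLess e e') \<sigma> \<longleftrightarrow> eval_index e \<sigma> < eval_index e' \<sigma>"
| "eval_test (DistLess u v) \<sigma> \<longleftrightarrow> dist_reg \<sigma> u < dist_reg \<sigma> v"

text \<open>
  \<open>exec A P \<sigma> t \<tau>\<close>: on input \<open>A\<close>, program \<open>P\<close> started in \<open>\<sigma>\<close> halts in \<open>\<tau>\<close> after \<open>t\<close> elementary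
  operations.  Besides the look-ups and comparisons of matrix entries, every other instruction and
  every index test is charged one operation as well, so that no part of the computation is free.
\<close>

inductive exec ::
    "(nat \<Rightarrow> nat \<Rightarrow> nat \<Rightarrow> real) \<Rightarrow> program \<Rightarrow> machine \<Rightarrow> nat \<Rightarrow> machine \<Rightarrow> bool"
  for A where
  Skip: "exec A Skip \<sigma> 1 \<sigma>"
| SetIndex: "exec A (SetIndex i e) \<sigma> 1 (\<sigma>\<lparr>index := (index \<sigma>)(i := eval_index e \<sigma>)\<rparr>)"
| LookUp: "exec A (LookUp v s i j) \<sigma> 1
    (\<sigma>\<lparr>dist_reg := (dist_reg \<sigma>)(v := A (eval_index s \<sigma>) (eval_index i \<sigma>) (eval_index j \<sigma>))\<rparr>)"
| Copy: "exec A (Copy u v) \<sigma> 1 (\<sigma>\<lparr>dist_reg := (dist_reg \<sigma>)(u := dist_reg \<sigma> v)\<rparr>)"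
| Emit: "exec A (Emit s u v) \<sigma> 1
    (\<sigma>\<lparr>diagrams := (diagrams \<sigma>)(eval_index s \<sigma> :=
        add_mset (dist_reg \<sigma> u, dist_reg \<sigma> v) (diagrams \<sigma> (eval_index s \<sigma>)))\<rparr>)"
| Seq: "exec A P \<sigma> t \<sigma>' \<Longrightarrow> exec A Q \<sigma>' t' \<sigma>'' \<Longrightarrow> exec A (Seq P Q) \<sigma> (t + t') \<sigma>''"
| Cond_True: "eval_test c \<sigma> \<Longrightarrow> exec A P \<sigma> t \<tau> \<Longrightarrow> exec A (Cond c P Q) \<sigma> (1 + t) \<tau>"
| Cond_False: "\<not> eval_test c \<sigma> \<Longrightarrow> exec A Q \<sigma> t \<tau> \<Longrightarrow> exec A (Cond c P Q) \<sigma> (1 + t) \<tau>"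
| Loop_False: "\<not> eval_test c \<sigma> \<Longrightarrow> exec A (Loop c P) \<sigma> 1 \<sigma>"
| Loop_True: "eval_test c \<sigma> \<Longrightarrow> exec A P \<sigma> t \<sigma>' \<Longrightarrow> exec A (Loop c P) \<sigma>' t' \<sigma>'' \<Longrightarrow>
    exec A (Loop c P) \<sigma> (1 + t + t') \<sigma>''"

text \<open>Initially, index registers 0 and 1 hold the matrix size \<open>n\<close> and the number \<open>N\<close> of samples.\<close>

definition start :: "nat \<Rightarrow> nat \<Rightarrow> machine" where
  "start n N = \<lparr>index = (\<lambda>_. 0)(0 := n, 1 := N), dist_reg = (\<lambda>_. 0), diagrams = (\<lambda>_. {#})\<rparr>"

end

theory Submission
  imports Defs
begin

text \<open>
  A clique complex on at most \<open>2k + 2\<close> vertices has nonzero reduced homology in degree \<open>k\<close> only if there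
  are exactly \<open>2k + 2\<close> vertices and every vertex misses exactly one other, that is, if the complex is
  the boundary of a cross-polytope: by Mayer--Vietoris, nonzero homology passes to the link of every
  vertex, and the link of a vertex that is not a cone point has at most \<open>2k\<close> vertices, so induction
  applies.  In a distance matrix, every row has exactly one entry above \<open>r\<close> iff
  \<open>b \<le> r < e\<close>, where \<open>b\<close> is the maximum over the rows of the second largest entry and \<open>e\<close> is the
  minimum over the rows of the largest entry.  On \<open>[b, e)\<close> the complex does not change, so \<open>(b, e)\<close> is
  the only possible point of the diagram, and one pass over the matrix finds it.
\<close>

section \<open>Clique complexes, alternating chains and their boundary\<close>

definition clique_complex :: "'a set \<Rightarrow> ('a \<Rightarrow> 'a \<Rightarrow> bool) \<Rightarrow> 'a set set" where
  "clique_complex V R = {\<sigma>. \<sigma> \<noteq> {} \<and> \<sigma> \<subseteq> V \<and> (\<forall>x\<in>\<sigma>. \<forall>y\<in>\<sigma>. R x y)}"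

definition alternating :: "('a list \<Rightarrow> 'f::field) \<Rightarrow> bool" where
  "alternating c \<longleftrightarrow> (\<forall>us a b vs. c (us @ [a, b] @ vs) = - c (us @ [b, a] @ vs))"

lemma alternatingD:
  assumes "alternating c"
  shows "c (us @ a # b # vs) = - c (us @ b # a # vs)"
proof -
  have "c (us @ [a, b] @ vs) = - c (us @ [b, a] @ vs)"
    using assms unfolding alternating_def by blast
  then show ?thesis by simp
qed

lemma alternating_swap:
  assumes "alternating c"
  shows "c (a # b # vs) = - c (b # a # vs)"
  using alternatingD[OF assms, where us = "[]"] unfolding append_Nil .

lemma alternatingI:
  assumes "\<And>us a b vs. c (us @ a # b # vs) = - c (us @ b # a # vs)"
  shows "alternating c"
  unfolding alternating_def append_Cons append_Nil using assms by blast

lemma alternating_Cons: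
  assumes "alternating c"
  shows "alternating (\<lambda>ys. c (x # ys))"
  by (rule alternatingI) (metis append_Cons alternatingD[OF assms])

lemma alternating_add:
  "alternating b \<Longrightarrow> alternating c \<Longrightarrow> alternating (\<lambda>xs. b xs + c xs)"
  unfolding alternating_def by (metis minus_add_distrib)

lemma alternating_scale:
  "alternating c \<Longrightarrow> alternating (\<lambda>xs. a * c xs)"
  unfolding alternating_def by (metis mult_minus_right)

lemma alternating_restrict:
  assumes "alternating c"
  shows "alternating (\<lambda>xs. if v \<in> set xs then 0 else c xs)"
proof (rule alternatingI)
  fix us a b vs
  show "(if v \<in> set (us @ a # b # vs) then 0 else c (us @ a # b # vs)) =
      - (if v \<in> set (us @ b # a # vs) then 0 else c (us @ b # a # vs))"
    by (cases "v \<in> set (us @ a # b # vs)") (simp_all only: set_append list.set(2) Un_iff insert_iff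
      alternatingD[OF assms, of us a b vs] minus_zero simp_thms if_True if_False disj_commute disj_left_commute)
qed

lemma chains_clique_iff:
  "c \<in> chains (clique_complex V R) m \<longleftrightarrow>
    (\<forall>xs. c xs \<noteq> 0 \<longrightarrow> length xs = m \<and> distinct xs \<and> set xs \<subseteq> V \<and> (\<forall>x\<in>set xs. \<forall>y\<in>set xs. R x y)) \<and>
    alternating c"
  unfolding chains_def alternating_def[symmetric] by (auto simp: clique_complex_def)

lemma chains_cliqueD:
  assumes "c \<in> chains (clique_complex V R) m" "c xs \<noteq> 0"
  shows "length xs = m" "distinct xs" "set xs \<subseteq> V"
    "\<And>x y. x \<in> set xs \<Longrightarrow> y \<in> set xs \<Longrightarrow> R x y"
  using assms unfolding chains_clique_iff by blast+

lemma chains_alternating: "c \<in> chains K m \<Longrightarrow> alternating c"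
  unfolding chains_def alternating_def by blast

lemma chains_zero: "0 \<in> chains K m"
  by (simp add: chains_def)

lemma chains_add: "b \<in> chains K m \<Longrightarrow> c \<in> chains K m \<Longrightarrow> (\<lambda>xs. b xs + c xs) \<in> chains K m"
  unfolding chains_def alternating_def[symmetric] mem_Collect_eq
  by (intro conjI allI impI alternating_add) (metis add.right_neutral)+

lemma chains_scale: "c \<in> chains K m \<Longrightarrow> (\<lambda>xs. a * c xs) \<in> chains K m"
  unfolding chains_def alternating_def[symmetric] by (auto intro: alternating_scale)

lemma chains_clique_mono:
  assumes "c \<in> chains (clique_complex V R) m"
    and "V \<subseteq> W" "\<And>x y. x \<in> V \<Longrightarrow> y \<in> V \<Longrightarrow> R x y \<Longrightarrow> S x y"
  shows "c \<in> chains (clique_complex W S) m"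
  using assms unfolding chains_clique_iff by (meson subset_iff)

text \<open>Reflexivity makes every singleton a simplex, so the vertices of the complex are all of
  \<open>V\<close>. For the relation \<open>d x y \<le> r\<close> this is where
  \<open>0 \<le> r\<close> enters.\<close>

lemma boundary_clique:
  assumes "reflp_on V R"
  shows "boundary (clique_complex V R) c = (\<lambda>ys. \<Sum>v\<in>V. c (v # ys))"
proof -
  have "\<Union>(clique_complex V R) = V"
  proof
    show "\<Union>(clique_complex V R) \<subseteq> V" by (auto simp: clique_complex_def)
    show "V \<subseteq> \<Union>(clique_complex V R)"
    proof
      fix v assume "v \<in> V"
      then have "{v} \<in> clique_complex V R"
        using assms by (auto simp: clique_complex_def reflp_on_def)
      then show "v \<in> \<Union>(clique_complex V R)" by blast
    qed
  qed
  then show ?thesis by (simp add: boundary_def)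
qed

lemma boundary_zero: "boundary K 0 = 0"
  by (simp add: boundary_def fun_eq_iff)

lemma boundary_add: "boundary K (\<lambda>xs. b xs + c xs) = (\<lambda>ys. boundary K b ys + boundary K c ys)"
  by (simp add: boundary_def sum.distrib)

lemma boundary_scale: "boundary K (\<lambda>xs. a * c xs) = (\<lambda>ys. a * boundary K c ys)"
  by (simp add: boundary_def sum_distrib_left)

text \<open>A chain on \<open>W\<close> vanishes on lists with an entry outside \<open>W\<close>, so
  the additional summands are zero. Boundaries can thus be computed in the link, the deletion or the
  whole complex alike.\<close>

lemma boundary_subset:
  assumes "c \<in> chains (clique_complex W R) m" "W \<subseteq> V" "finite V" "reflp_on V R"
  shows "boundary (clique_complex V R) c = boundary (clique_complex W R) c"
proof -
  have "(\<Sum>v\<in>V. c (v # ys)) = (\<Sum>v\<in>W. c (v # ys))" for ys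
    using assms(1-3) by (intro sum.mono_neutral_right) (auto dest: chains_cliqueD(3))
  moreover have "reflp_on W R" using assms(2,4) by (rule reflp_on_subset[rotated])
  ultimately show ?thesis using assms(4) by (simp add: boundary_clique)
qed

section \<open>Cones\<close>

text \<open>\<open>cone v c\<close> is the chain \<open>[v, c]\<close> of the join; each vertex in front of \<open>v\<close> costs a sign.\<close>

fun cone :: "'a \<Rightarrow> ('a list \<Rightarrow> 'f::field) \<Rightarrow> 'a list \<Rightarrow> 'f" where
  "cone v c [] = 0"
| "cone v c (x # xs) = (if x = v then c xs else - cone v (\<lambda>ys. c (x # ys)) xs)"

lemma cone_zero [simp]: "cone v (\<lambda>ys. 0) xs = 0"
  by (induction xs) auto

lemma cone_uminus: "cone v (\<lambda>ys. - c ys) xs = - cone v c xs"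
  by (induction xs arbitrary: c) auto

lemma cone_sum: "cone v (\<lambda>ys. \<Sum>u\<in>U. c u ys) xs = (\<Sum>u\<in>U. cone v (c u) xs)"
proof (induction xs arbitrary: c)
  case (Cons x xs)
  then show ?case by (simp add: sum_negf)
qed simp

lemma cone_nonzero:
  "cone v c xs \<noteq> 0 \<Longrightarrow> \<exists>us ys. xs = us @ v # ys \<and> c (us @ ys) \<noteq> 0"
proof (induction xs arbitrary: c)
  case (Cons x xs)
  show ?case
  proof (cases "x = v")
    case True
    then show ?thesis using Cons.prems by (intro exI[of _ "[]"] exI[of _ xs]) auto
  next
    case False
    then obtain us ys where "xs = us @ v # ys" "c (x # us @ ys) \<noteq> 0"
      using Cons.IH[of "\<lambda>ys. c (x # ys)"] Cons.prems by auto
    then show ?thesis by (intro exI[of _ "x # us"] exI[of _ ys]) auto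
  qed
qed simp

text \<open>The vanishing assumption settles \<open>a = b = v\<close>, where the sign rule demands
  \<open>c (v # vs) = - c (v # vs)\<close>. If only one of the two is \<open>v\<close>, the sign
  built into \<open>cone\<close> does it.\<close>

lemma cone_alternating:
  assumes "alternating c" "\<And>xs. v \<in> set xs \<Longrightarrow> c xs = 0"
  shows "alternating (cone v c)"
proof -
  have "cone v c (us @ a # b # vs) = - cone v c (us @ b # a # vs)" for us a b vs
    using assms
  proof (induction us arbitrary: c)
    case Nil
    have "cone v (\<lambda>ys. c (a # b # ys)) vs = - cone v (\<lambda>ys. c (b # a # ys)) vs"
      unfolding cone_uminus[symmetric] by (subst alternating_swap[OF Nil(1)]) (rule refl)
    then show ?case using Nil(2) by (cases "a = v"; cases "b = v") auto
  next
    case (Cons u us)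
    show ?case
    proof (cases "u = v")
      case True
      then show ?thesis by (simp only: append_Cons cone.simps refl if_True alternatingD[OF Cons.prems(1), of us a b vs])
    next
      case False
      then show ?thesis
        using Cons.IH[of "\<lambda>ys. c (u # ys)", OF alternating_Cons[OF Cons.prems(1)]] Cons.prems(2) by simp
    qed
  qed
  then show ?thesis by (rule alternatingI)
qed

text \<open>Moving \<open>v\<close> to the front costs one sign for each entry passed, which is the
  sign that \<open>cone\<close> inserts on the way back. Coning off the slice at \<open>v\<close>
  therefore recovers the part of \<open>c\<close> on simplices through \<open>v\<close>.\<close>

lemma cone_slice:
  assumes "alternating c"
  shows "cone v (\<lambda>ys. c (v # ys)) xs = (if v \<in> set xs then c xs else 0)"
  using assms
proof (induction xs arbitrary: c)
  case (Cons x xs)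
  show ?case
  proof (cases "x = v")
    case False
    have swap: "c (v # x # ys) = - c (x # v # ys)" for ys
      by (rule alternating_swap[OF Cons.prems])
    have "cone v (\<lambda>ys. c (v # ys)) (x # xs) = - cone v (\<lambda>ys. c (v # x # ys)) xs"
      using False by simp
    also have "\<dots> = cone v (\<lambda>ys. c (x # v # ys)) xs"
      unfolding swap cone_uminus by (rule minus_minus)
    also have "\<dots> = (if v \<in> set xs then c (x # xs) else 0)"
      by (rule Cons.IH[OF alternating_Cons[OF Cons.prems]])
    finally show ?thesis using False by simp
  qed simp
qed simp

lemma cone_chains:
  assumes c: "c \<in> chains (clique_complex W R) m" and "v \<in> V" "v \<notin> W" "W \<subseteq> V" "R v v"
    and adj: "\<And>u. u \<in> W \<Longrightarrow> R v u \<and> R u v"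
  shows "cone v c \<in> chains (clique_complex V R) (Suc m)"
  unfolding chains_clique_iff
proof (intro conjI allI impI)
  fix xs assume "cone v c xs \<noteq> 0"
  from cone_nonzero[OF this] obtain us ys where xs: "xs = us @ v # ys" "c (us @ ys) \<noteq> 0"
    by (elim exE conjE)
  note D = chains_cliqueD[OF c xs(2)]
  show "length xs = Suc m" using D(1) xs(1) by simp
  show "distinct xs" using D(2,3) xs(1) \<open>v \<notin> W\<close> by auto
  show "set xs \<subseteq> V" using D(3) xs(1) assms by auto
  show "\<forall>x\<in>set xs. \<forall>y\<in>set xs. R x y"
  proof (intro ballI)
    fix x y assume "x \<in> set xs" "y \<in> set xs"
    moreover have "set xs = insert v (set (us @ ys))" using xs(1) by auto
    ultimately show "R x y" using D(3,4) adj \<open>R v v\<close> by auto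
  qed
next
  show "alternating (cone v c)"
    using \<open>v \<notin> W\<close> by (intro cone_alternating chains_alternating[OF c]) (auto dest: chains_cliqueD(3)[OF c])
qed

text \<open>The homotopy formula of a cone: putting \<open>v\<close> in front gives
  \<open>c\<close>, and putting any other \<open>u\<close> in front passes the boundary under the
  cone with a sign. The term \<open>u = v\<close> can be added to the second sum because
  \<open>c\<close> vanishes there.\<close>

lemma boundary_cone:
  assumes "finite V" "v \<in> V" "reflp_on V R" "\<And>ys. c (v # ys) = 0"
  shows "boundary (clique_complex V R) (cone v c) =
    (\<lambda>ys. c ys - cone v (boundary (clique_complex V R) c) ys)"
proof
  fix ys
  have "(\<Sum>u\<in>V. cone v c (u # ys)) = c ys + (\<Sum>u\<in>V-{v}. cone v c (u # ys))"
    using assms(1,2) by (simp add: sum.remove)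
  also have "(\<Sum>u\<in>V-{v}. cone v c (u # ys)) = - (\<Sum>u\<in>V-{v}. cone v (\<lambda>xs. c (u # xs)) ys)"
    by (simp add: sum_negf[symmetric])
  also have "(\<Sum>u\<in>V-{v}. cone v (\<lambda>xs. c (u # xs)) ys) = (\<Sum>u\<in>V. cone v (\<lambda>xs. c (u # xs)) ys)"
    using assms(1,2,4) by (simp add: sum.remove)
  finally show "boundary (clique_complex V R) (cone v c) ys =
      c ys - cone v (boundary (clique_complex V R) c) ys"
    using assms(3) by (simp add: boundary_clique cone_sum)
qed

section \<open>Homology of clique complexes with few vertices\<close>

text \<open>The vertex set of the link of \<open>v\<close>; in a clique complex the link is again
  the clique complex of the induced graph.\<close>

definition nbh :: "'a set \<Rightarrow> ('a \<Rightarrow> 'a \<Rightarrow> bool) \<Rightarrow> 'a \<Rightarrow> 'a set" where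
  "nbh V R v = {u \<in> V. u \<noteq> v \<and> R v u}"

text \<open>For reflexive symmetric \<open>R\<close> the non-adjacent pairs form a perfect matching,
  and the clique complex is the boundary of the cross-polytope with these antipodal pairs.\<close>

definition cocktail_party :: "'a set \<Rightarrow> ('a \<Rightarrow> 'a \<Rightarrow> bool) \<Rightarrow> bool" where
  "cocktail_party V R \<longleftrightarrow> (\<forall>v\<in>V. \<exists>!u. u \<in> V \<and> \<not> R v u)"

section \<open>The link and the deletion of a vertex\<close>

lemma slice_chains:
  assumes "c \<in> chains (clique_complex V R) (Suc m)"
  shows "(\<lambda>ys. c (v # ys)) \<in> chains (clique_complex (nbh V R v) R) m"
  unfolding chains_clique_iff
proof (intro conjI allI impI)
  fix ys assume "c (v # ys) \<noteq> 0"
  note D = chains_cliqueD[OF assms this]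
  show "length ys = m" "distinct ys" "set ys \<subseteq> nbh V R v" "\<forall>x\<in>set ys. \<forall>y\<in>set ys. R x y"
    using D by (auto simp: nbh_def)
qed (rule alternating_Cons[OF chains_alternating[OF assms]])

text \<open>Exchanging the first two entries changes the sign, so slicing at \<open>v\<close>
  anticommutes with the boundary.\<close>

lemma slice_cycle:
  assumes c: "c \<in> chains (clique_complex V R) (Suc m)" "boundary (clique_complex V R) c = 0"
    and V: "finite V" "reflp_on V R"
  shows "boundary (clique_complex (nbh V R v) R) (\<lambda>ys. c (v # ys)) = 0"
proof -
  have "boundary (clique_complex (nbh V R v) R) (\<lambda>ys. c (v # ys)) =
      boundary (clique_complex V R) (\<lambda>ys. c (v # ys))"
    by (rule boundary_subset[OF slice_chains[OF c(1), of v] _ V, symmetric]) (auto simp: nbh_def)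
  also have "\<dots> = (\<lambda>ys. \<Sum>u\<in>V. c (v # u # ys))"
    by (rule boundary_clique[OF V(2)])
  also have "\<dots> = (\<lambda>ys. - boundary (clique_complex V R) c (v # ys))"
  proof
    fix ys
    have "c (v # u # ys) = - c (u # v # ys)" for u
      by (rule alternating_swap[OF chains_alternating[OF c(1)]])
    then show "(\<Sum>u\<in>V. c (v # u # ys)) = - boundary (clique_complex V R) c (v # ys)"
      by (simp add: boundary_clique[OF V(2)] sum_negf)
  qed
  finally show ?thesis by (simp add: c(2) zero_fun_def)
qed

lemma restrict_chains:
  assumes "c \<in> chains (clique_complex V R) m"
  shows "(\<lambda>xs. if v \<in> set xs then 0 else c xs) \<in> chains (clique_complex (V - {v}) R) m"
  unfolding chains_clique_iff
proof (intro conjI allI impI)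
  fix xs assume "(if v \<in> set xs then 0 else c xs) \<noteq> 0"
  then have v: "v \<notin> set xs" and "c xs \<noteq> 0" by (auto split: if_splits)
  note D = chains_cliqueD[OF assms this(2)]
  show "length xs = m" "distinct xs" "set xs \<subseteq> V - {v}" "\<forall>x\<in>set xs. \<forall>y\<in>set xs. R x y"
    using D v by auto
qed (rule alternating_restrict[OF chains_alternating[OF assms]])

text \<open>The cycle condition says that the values \<open>c (u # ys)\<close> sum to zero over
  \<open>u\<close> in \<open>V\<close>; dropping \<open>u = v\<close> leaves
  \<open>- c (v # ys)\<close>. If \<open>ys\<close> runs through \<open>v\<close>, both sides are
  zero.\<close>

lemma boundary_restrict:
  assumes c: "c \<in> chains (clique_complex V R) m" "boundary (clique_complex V R) c = 0"
    and V: "finite V" "reflp_on V R" "v \<in> V"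
  shows "boundary (clique_complex V R) (\<lambda>xs. if v \<in> set xs then 0 else c xs) = (\<lambda>ys. - c (v # ys))"
proof
  fix ys
  show "boundary (clique_complex V R) (\<lambda>xs. if v \<in> set xs then 0 else c xs) ys = - c (v # ys)"
  proof (cases "v \<in> set ys")
    case True
    then have "c (v # ys) = 0" using chains_cliqueD(2)[OF c(1), of "v # ys"] by auto
    with True show ?thesis by (simp add: boundary_clique[OF V(2)])
  next
    case False
    have "0 = (\<Sum>u\<in>V. c (u # ys))"
      using fun_cong[OF c(2), of ys] by (simp add: boundary_clique[OF V(2)])
    also have "\<dots> = c (v # ys) + (\<Sum>u\<in>V-{v}. c (u # ys))"
      using V by (simp add: sum.remove)
    finally have "(\<Sum>u\<in>V-{v}. c (u # ys)) = - c (v # ys)"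
      by (simp add: eq_neg_iff_add_eq_0 add.commute)
    moreover have "(\<Sum>u\<in>V. if v \<in> set (u # ys) then 0 else c (u # ys)) = (\<Sum>u\<in>V-{v}. c (u # ys))"
      using V False by (intro sum.mono_neutral_cong_right) auto
    ultimately show ?thesis by (simp add: boundary_clique[OF V(2)])
  qed
qed

text \<open>\<open>m\<close> counts vertices, so this is exactness in degree \<open>m - 1\<close>.\<close>

definition exact_at :: "'f::field itself \<Rightarrow> 'a set set \<Rightarrow> nat \<Rightarrow> bool" where
  "exact_at F K m \<longleftrightarrow> (\<forall>z :: 'a list \<Rightarrow> 'f. z \<in> chains K m \<longrightarrow> boundary K z = 0 \<longrightarrow>
     z \<in> boundary K ` chains K (Suc m))"

text \<open>
  The Mayer--Vietoris step for the union of the star of \<open>v\<close> and the complex without \<open>v\<close>, which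
  meet in the link.
\<close>

lemma exact_step:
  fixes z :: "'a list \<Rightarrow> 'f::field"
  assumes V: "finite V" "reflp_on V R" "symp_on V R" "v \<in> V"
    and del: "exact_at TYPE('f) (clique_complex (V - {v}) R) (Suc m)"
    and z: "z \<in> chains (clique_complex V R) (Suc m)" "boundary (clique_complex V R) z = 0"
    and w: "w \<in> chains (clique_complex (nbh V R v) R) (Suc m)"
      "boundary (clique_complex (nbh V R v) R) w = (\<lambda>ys. z (v # ys))"
  shows "z \<in> boundary (clique_complex V R) ` chains (clique_complex V R) (Suc (Suc m))"
proof -
  let ?K = "clique_complex V R" and ?L = "clique_complex (V - {v}) R"
  \<comment> \<open>The part of \<open>z\<close> off \<open>v\<close> has boundary minus the slice
    of \<open>z\<close> at \<open>v\<close>; adding the filling \<open>w\<close> of that slice gives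
    a cycle of the deletion.\<close>
  let ?z' = "\<lambda>xs. (if v \<in> set xs then 0 else z xs) + w xs"
  have sub: "nbh V R v \<subseteq> V" and subv: "nbh V R v \<subseteq> V - {v}" by (auto simp: nbh_def)
  have bw: "boundary ?K w = (\<lambda>ys. z (v # ys))"
    using boundary_subset[OF w(1) sub V(1,2)] w(2) by simp
  have wv: "w (v # ys) = 0" for ys
    using chains_cliqueD(3)[OF w(1), of "v # ys"] by (auto simp: nbh_def)
  have cw: "cone v w \<in> chains ?K (Suc (Suc m))"
    using V w(1) by (intro cone_chains[where W = "nbh V R v"]) (auto simp: nbh_def reflp_on_def symp_on_def)
  have bcw: "boundary ?K (cone v w) = (\<lambda>ys. w ys - (if v \<in> set ys then z ys else 0))"
    using boundary_cone[OF V(1,4,2), of w, OF wv]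
    by (simp add: bw cone_slice[OF chains_alternating[OF z(1)]])
  have z'c: "?z' \<in> chains ?L (Suc m)"
    by (rule chains_add[OF restrict_chains[OF z(1)] chains_clique_mono[OF w(1) subv]])
  have "boundary ?L ?z' = boundary ?K ?z'"
    using boundary_subset[OF z'c _ V(1,2)] by auto
  also have "\<dots> = 0"
    unfolding boundary_add boundary_restrict[OF z V(1,2,4)] bw by (simp add: zero_fun_def)
  finally have "?z' \<in> boundary ?L ` chains ?L (Suc (Suc m))"
    using del z'c unfolding exact_at_def by blast
  then obtain u where u: "u \<in> chains ?L (Suc (Suc m))" "?z' = boundary ?L u" by blast
  have "boundary ?K u = ?z'"
    using boundary_subset[OF u(1) _ V(1,2)] u(2) by auto
  moreover have "u \<in> chains ?K (Suc (Suc m))"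
    by (rule chains_clique_mono[OF u(1)]) auto
  \<comment> \<open>The boundary of \<open>u\<close> is the part of \<open>z\<close> off
    \<open>v\<close> plus \<open>w\<close>, and that of \<open>cone v w\<close> is \<open>w\<close>
    minus the part of \<open>z\<close> through \<open>v\<close>; the difference is
    \<open>z\<close>.\<close>
  ultimately have "(\<lambda>xs. u xs + (-1) * cone v w xs) \<in> chains ?K (Suc (Suc m))"
    "boundary ?K (\<lambda>xs. u xs + (-1) * cone v w xs) = z"
    using chains_add[OF _ chains_scale[OF cw, of "-1"]]
    unfolding boundary_add boundary_scale bcw by auto
  then show ?thesis by blast
qed

text \<open>Induction on \<open>m + card V\<close>: the deletion of \<open>v\<close> keeps
  \<open>m\<close> and has fewer vertices, the link lowers both. The deletion has fewer than
  \<open>2 * m\<close> vertices, so it is never the exceptional case.\<close>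

lemma exact_few_vertices:
  assumes "finite V" "reflp_on V R" "symp_on V R" "card V \<le> 2 * m"
    and "\<not> (card V = 2 * m \<and> cocktail_party V R)"
  shows "exact_at TYPE('f::field) (clique_complex V R) m"
  using assms
proof (induction "m + card V" arbitrary: m V rule: less_induct)
  case less
  show ?case
  proof (cases m)
    case 0
    then have "V = {}" using less.prems by simp
    \<comment> \<open>The empty set is vacuously a cocktail party graph on \<open>2 * 0\<close>
      vertices, so the last hypothesis excludes this case.\<close>
    then show ?thesis using less.prems 0 by (simp add: cocktail_party_def)
  next
    case (Suc m')
    show ?thesis
    proof (cases "V = {}")
      case True
      have "z = 0" if "z \<in> chains (clique_complex V R) m" for z :: "'a list \<Rightarrow> 'f"
      proof
        fix xs show "z xs = 0 xs"
          using chains_cliqueD(1,3)[OF that, of xs] Suc True by (cases "z xs = 0") auto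
      qed
      then show ?thesis
        unfolding exact_at_def by (metis boundary_zero chains_zero image_eqI)
    next
      case False
      \<comment> \<open>If \<open>card V = 2 * m\<close>, some vertex has either no non-neighbour or
        at least two; if \<open>card V < 2 * m\<close>, any vertex will do. Either \<open>v\<close>
        is a cone point or its link has at most \<open>2 * m - 3\<close> vertices, fewer than
        \<open>2 * m'\<close>.\<close>
      obtain v where v: "v \<in> V" and "nbh V R v = V - {v} \<or>
          card (nbh V R v) \<le> 2 * m' \<and> \<not> (card (nbh V R v) = 2 * m' \<and> cocktail_party (nbh V R v) R)"
      proof -
        have nb: "card (nbh V R v) + card {u \<in> V. \<not> R v u} + 1 = card V" if "v \<in> V" for v
        proof -
          have "R v v" using that less.prems(2) by (auto simp: reflp_on_def)
          then have "V = insert v (nbh V R v \<union> {u \<in> V. \<not> R v u})"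
            using that by (auto simp: nbh_def)
          then have "card V = card (insert v (nbh V R v \<union> {u \<in> V. \<not> R v u}))" by simp
          also have "\<dots> = 1 + card (nbh V R v \<union> {u \<in> V. \<not> R v u})"
            using less.prems(1) \<open>R v v\<close> by (subst card_insert_disjoint) (auto simp: nbh_def)
          also have "card (nbh V R v \<union> {u \<in> V. \<not> R v u}) = card (nbh V R v) + card {u \<in> V. \<not> R v u}"
            using less.prems(1) by (intro card_Un_disjoint) (auto simp: nbh_def)
          finally show ?thesis by simp
        qed
        have cone: "nbh V R v = V - {v}" if "v \<in> V" "card {u \<in> V. \<not> R v u} = 0" for v
          using that less.prems(1) by (auto simp: nbh_def)
        show ?thesis
        proof (cases "card V = 2 * m")
          case True
          then obtain v where v: "v \<in> V" "\<not> (\<exists>!u. u \<in> V \<and> \<not> R v u)"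
            using less.prems(5) unfolding cocktail_party_def by blast
          have "card {u \<in> V. \<not> R v u} \<noteq> 1"
          proof
            assume "card {u \<in> V. \<not> R v u} = 1"
            then obtain u where "{u \<in> V. \<not> R v u} = {u}" by (rule card_1_singletonE)
            then show False using v(2) by (metis (mono_tags, lifting) mem_Collect_eq singletonD singletonI)
          qed
          then show ?thesis
            using that[OF v(1)] nb[OF v(1)] cone[OF v(1)] True Suc by linarith
        next
          case neq: False
          obtain v where v: "v \<in> V" using False by blast
          show ?thesis
            using that[OF v(1)] nb[OF v(1)] cone[OF v(1)] neq less.prems(4) Suc by linarith
        qed
      qed
      note v = this
      have sub: "V - {v} \<subseteq> V" "nbh V R v \<subseteq> V" by (auto simp: nbh_def)
      have fin: "finite (V - {v})" "finite (nbh V R v)"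
        using less.prems(1) sub by (auto intro: finite_subset)
      have cardv: "card (V - {v}) < card V"
        using v(1) less.prems(1) by (rule card_Diff1_less[rotated])
      have del: "exact_at TYPE('f) (clique_complex (V - {v}) R) (Suc m')"
        using less.hyps[of m "V - {v}"] cardv less.prems fin
          reflp_on_subset[OF less.prems(2) sub(1)] symp_on_subset[OF less.prems(3) sub(1)] Suc
        by auto
      show ?thesis
        unfolding exact_at_def Suc
      proof (intro allI impI)
        fix z :: "'a list \<Rightarrow> 'f"
        assume z: "z \<in> chains (clique_complex V R) (Suc m')" "boundary (clique_complex V R) z = 0"
        have "\<exists>w. w \<in> chains (clique_complex (nbh V R v) R) (Suc m') \<and>
            boundary (clique_complex (nbh V R v) R) w = (\<lambda>ys. z (v # ys))"
        proof (cases "nbh V R v = V - {v}")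
          case True
          \<comment> \<open>Here the link is the whole deletion, and the negated part of
            \<open>z\<close> off \<open>v\<close> fills the slice.\<close>
          let ?w = "\<lambda>xs. if v \<in> set xs then 0 else z xs"
          have w: "?w \<in> chains (clique_complex (V - {v}) R) (Suc m')"
            by (rule restrict_chains[OF z(1)])
          have "boundary (clique_complex (V - {v}) R) ?w = (\<lambda>ys. - z (v # ys))"
            using boundary_subset[OF w sub(1) less.prems(1,2)]
              boundary_restrict[OF z less.prems(1,2) v(1)] by simp
          then have "boundary (clique_complex (V - {v}) R) (\<lambda>xs. (-1) * ?w xs) = (\<lambda>ys. z (v # ys))"
            by (simp only: boundary_scale) simp
          then show ?thesis using chains_scale[OF w, of "-1"] True by metis
        next
          case False
          have "card (nbh V R v) < card V"
            using psubset_card_mono[of V "nbh V R v"] less.prems(1) v(1) by (auto simp: nbh_def)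
          then have "exact_at TYPE('f) (clique_complex (nbh V R v) R) m'"
            using less.hyps[of m' "nbh V R v"] v(2) False fin
              reflp_on_subset[OF less.prems(2) sub(2)] symp_on_subset[OF less.prems(3) sub(2)] Suc
            by auto
          then show ?thesis
            using slice_chains[OF z(1), of v] slice_cycle[OF z less.prems(1,2), of v] Suc
            unfolding exact_at_def by fastforce
        qed
        then show "z \<in> boundary (clique_complex V R) ` chains (clique_complex V R) (Suc (Suc m'))"
          using exact_step[OF less.prems(1-3) v(1) del z] by blast
      qed
    qed
  qed
qed

text \<open>Disjointness of a clique from its set of antipodes bounds the dimension.\<close>

lemma cocktail_party_chains_zero:
  assumes V: "finite V" "symp_on V R" "cocktail_party V R" "card V = 2 * m"
    and c: "c \<in> chains (clique_complex V R) (Suc m)"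
  shows "c = 0"
proof
  fix xs
  show "c xs = 0 xs"
  proof (rule ccontr)
    assume "c xs \<noteq> 0 xs"
    then have "c xs \<noteq> 0" by simp
    note D = chains_cliqueD[OF c this]
    define f where "f v = (THE u. u \<in> V \<and> \<not> R v u)" for v
    have f: "f v \<in> V \<and> \<not> R v (f v)" if "v \<in> V" for v
      using theI'[of "\<lambda>u. u \<in> V \<and> \<not> R v u"] V(3) that by (auto simp: cocktail_party_def f_def)
    have ff: "f v = u" if "v \<in> V" "u \<in> V" "\<not> R v u" for u v
      using that f[of v] V(3) by (auto simp: cocktail_party_def)
    have inv: "f (f v) = v" if "v \<in> V" for v
    proof -
      have "\<not> R (f v) v" using f[OF that] that V(2) by (auto simp: symp_on_def)
      then show ?thesis using ff[of "f v" v] f[OF that] that by blast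
    qed
    have "inj_on f V" using inv by (metis inj_onI)
    then have "card (f ` set xs) = Suc m"
      using D(1-3) by (metis card_image distinct_card inj_on_subset)
    moreover have "set xs \<inter> f ` set xs = {}"
      using D(3,4) f by blast
    ultimately have "card (set xs \<union> f ` set xs) = 2 * Suc m"
      using D(1,2) by (simp add: card_Un_disjoint distinct_card)
    moreover have "card (set xs \<union> f ` set xs) \<le> card V"
      using D(3) f by (intro card_mono[OF V(1)]) blast
    ultimately show False using V(4) by simp
  qed
qed

text \<open>Cross-polytopes are suspensions: \<open>v\<close> and its antipode \<open>v'\<close> are
  not adjacent and have the same link, so they are the two poles over the cross-polytope on the
  other vertices.\<close>

lemma cocktail_party_nbh:
  assumes V: "finite V" "reflp_on V R" "symp_on V R" "cocktail_party V R" "v \<in> V"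
  obtains v' where "v' \<in> V" "\<not> R v v'" "\<not> R v' v" "nbh V R v = V - {v, v'}" "nbh V R v' = V - {v, v'}"
    "cocktail_party (V - {v, v'}) R" "card V = Suc (Suc (card (V - {v, v'})))"
proof -
  obtain v' where v': "v' \<in> V" "\<not> R v v'" and uniq: "\<And>u. u \<in> V \<Longrightarrow> \<not> R v u \<Longrightarrow> u = v'"
    using V(4,5) unfolding cocktail_party_def by metis
  have v'v: "\<not> R v' v" using v' V(3,5) by (auto simp: symp_on_def)
  then have uniq': "u = v" if "u \<in> V" "\<not> R v' u" for u
    using that v'(1) V(4,5) by (auto simp: cocktail_party_def)
  have "v \<noteq> v'" using v' V(2,5) by (auto simp: reflp_on_def)
  have nbh: "nbh V R v = V - {v, v'}" "nbh V R v' = V - {v, v'}"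
    unfolding nbh_def using v' v'v uniq uniq' by blast+
  have "cocktail_party (V - {v, v'}) R"
    unfolding cocktail_party_def
  proof
    fix u assume u: "u \<in> V - {v, v'}"
    then obtain w where w: "w \<in> V" "\<not> R u w" "\<And>w'. w' \<in> V \<Longrightarrow> \<not> R u w' \<Longrightarrow> w' = w"
      using V(4) unfolding cocktail_party_def by (metis Diff_iff)
    have "\<not> R w u" using V(3) u w(1,2) by (auto simp: symp_on_def)
    then have "w \<noteq> v" "w \<noteq> v'" using u uniq uniq' w(1) by blast+
    then show "\<exists>!w. w \<in> V - {v, v'} \<and> \<not> R u w" using w(1,2) by (intro ex1I[of _ w] w(3)) auto
  qed
  moreover have "card V = Suc (Suc (card (V - {v, v'})))"
  proof -
    have "card V = Suc (card (V - {v}))" using V(1,5) by (rule card.remove)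
    also have "card (V - {v}) = Suc (card (V - {v} - {v'}))"
      using V(1) v'(1) \<open>v \<noteq> v'\<close> by (intro card.remove) auto
    finally show ?thesis by (simp add: Diff_insert2 [symmetric])
  qed
  ultimately show ?thesis using that v' v'v nbh by blast
qed

text \<open>One-dimensionality of the cycle space in a form that hands over a coordinate: evaluation
  at \<open>xs\<close> is injective on cycles and takes the value 1. The induction suspends, and
  \<open>xs\<close> grows by one pole.\<close>

lemma cocktail_party_cycles:
  assumes "finite V" "reflp_on V R" "symp_on V R" "cocktail_party V R" "card V = 2 * m"
  shows "\<exists>xs.
    (\<exists>z :: 'a list \<Rightarrow> 'f::field. z \<in> chains (clique_complex V R) m \<and> boundary (clique_complex V R) z = 0 \<and> z xs = 1) \<and>
    (\<forall>z :: 'a list \<Rightarrow> 'f. z \<in> chains (clique_complex V R) m \<longrightarrow> boundary (clique_complex V R) z = 0 \<longrightarrow>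
       z xs = 0 \<longrightarrow> z = 0)"
  using assms
proof (induction m arbitrary: V)
  case 0
  then have [simp]: "V = {}" by simp
  \<comment> \<open>Over no vertices the empty list alone spans the chains of the augmented complex
    in degree -1.\<close>
  have 1: "(\<lambda>xs. if xs = [] then 1 else 0) \<in> chains (clique_complex V R) 0"
    by (auto simp: chains_clique_iff alternating_def)
  have 2: "boundary (clique_complex V R) z = 0" for z :: "'a list \<Rightarrow> 'f"
    using 0 by (simp add: boundary_clique zero_fun_def)
  have 3: "z = 0" if "z \<in> chains (clique_complex V R) 0" "z [] = 0" for z :: "'a list \<Rightarrow> 'f"
  proof
    fix xs show "z xs = 0 xs"
      using chains_cliqueD(1)[OF that(1), of xs] that(2) by (cases "z xs = 0") auto
  qed
  show ?case
  proof (intro exI[of _ "[]"] conjI allI impI)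
    show "\<exists>z :: 'a list \<Rightarrow> 'f. z \<in> chains (clique_complex V R) 0 \<and> boundary (clique_complex V R) z = 0 \<and> z [] = 1"
      by (rule exI[of _ "\<lambda>xs. if xs = [] then 1 else 0"]) (use 1 2 in auto)
  qed (rule 3)
next
  case (Suc m)
  note V = Suc.prems
  let ?K = "clique_complex V R"
  obtain v where v: "v \<in> V" using V(5) by fastforce
  obtain v' where v': "v' \<in> V" "\<not> R v v'" "\<not> R v' v" "nbh V R v = V - {v, v'}" "nbh V R v' = V - {v, v'}"
    "cocktail_party (V - {v, v'}) R" "card V = Suc (Suc (card (V - {v, v'})))"
    using cocktail_party_nbh[OF V(1-4) v] by blast
  define W where "W = V - {v, v'}"
  have W: "W \<subseteq> V" "v \<notin> W" "v' \<notin> W" "nbh V R v = W" "nbh V R v' = W"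
    using v' by (auto simp: W_def)
  have WR: "finite W" "reflp_on W R" "symp_on W R" "cocktail_party W R" "card W = 2 * m"
    using V v' W(1) reflp_on_subset[OF V(2)] symp_on_subset[OF V(3)] by (auto simp: W_def)
  obtain xs and w :: "'a list \<Rightarrow> 'f" where
    w: "w \<in> chains (clique_complex W R) m" "boundary (clique_complex W R) w = 0" "w xs = 1"
    and inj: "\<And>z :: 'a list \<Rightarrow> 'f. z \<in> chains (clique_complex W R) m \<Longrightarrow>
      boundary (clique_complex W R) z = 0 \<Longrightarrow> z xs = 0 \<Longrightarrow> z = 0"
    using Suc.IH[OF WR] by blast
  have bw: "boundary ?K w = 0" using boundary_subset[OF w(1) W(1) V(1,2)] w(2) by simp
  have w0: "w (u # ys) = 0" if "u \<notin> W" for u ys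
    using chains_cliqueD(3)[OF w(1), of "u # ys"] that by auto
  have cc: "cone u w \<in> chains ?K (Suc m)" "boundary ?K (cone u w) = w"
    if u: "u \<in> V" "u \<notin> W" "nbh V R u = W" for u
  proof -
    show "cone u w \<in> chains ?K (Suc m)"
      using V(2,3) u by (intro cone_chains[OF w(1) u(1,2) W(1)]) (auto simp: nbh_def reflp_on_def symp_on_def)
    show "boundary ?K (cone u w) = w"
      using boundary_cone[OF V(1) u(1) V(2), of w, OF w0[OF u(2)]] by (simp add: bw zero_fun_def)
  qed
  note c1 = cc[OF v W(2,4)] and c2 = cc[OF v'(1) W(3,5)]
  \<comment> \<open>The suspension of the cycle \<open>w\<close>: both cones have boundary
    \<open>w\<close>, and only the cone at \<open>v\<close> is nonzero at
    \<open>v # xs\<close>.\<close>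
  let ?z = "\<lambda>ys. cone v w ys + (-1) * cone v' w ys"
  have "?z \<in> chains ?K (Suc m)" by (intro chains_add chains_scale c1 c2)
  moreover have "boundary ?K ?z = 0"
    unfolding boundary_add boundary_scale c1(2) c2(2) by (simp add: zero_fun_def)
  moreover have "?z (v # xs) = 1"
  proof -
    have "v \<noteq> v'" using v'(2) v V(2) by (auto simp: reflp_on_def)
    moreover have "(\<lambda>ys. w (v # ys)) = (\<lambda>ys. 0)" using w0[OF W(2)] by auto
    ultimately show ?thesis using w(3) by simp
  qed
  moreover have "z = 0" if z: "z \<in> chains ?K (Suc m)" "boundary ?K z = 0" "z (v # xs) = 0"
    for z :: "'a list \<Rightarrow> 'f"
  proof -
    \<comment> \<open>By induction the slice at \<open>v\<close> vanishes, so \<open>z\<close> lives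
      on \<open>V - {v}\<close>. With too few vertices for a cross-polytope, that complex is exact,
      but it has no simplices of the dimension that could fill a nonzero \<open>z\<close>.\<close>
    have "(\<lambda>ys. z (v # ys)) = 0"
      using inj slice_chains[OF z(1), of v] slice_cycle[OF z(1,2) V(1,2), of v] z(3) by (simp add: W(4))
    then have "z ys = 0" if "v \<in> set ys" for ys
      using cone_slice[OF chains_alternating[OF z(1)], of v ys] that by (simp add: zero_fun_def)
    then have "(\<lambda>ys. if v \<in> set ys then 0 else z ys) = z" by auto
    with restrict_chains[OF z(1), of v] have zv: "z \<in> chains (clique_complex (V - {v}) R) (Suc m)"
      by simp
    have sub: "V - {v} \<subseteq> V" by blast
    have "card (V - {v}) < 2 * Suc m" using V(1,5) v by (metis card_Diff1_less)
    then have "exact_at TYPE('f) (clique_complex (V - {v}) R) (Suc m)"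
      using V(1) reflp_on_subset[OF V(2) sub] symp_on_subset[OF V(3) sub]
      by (intro exact_few_vertices) auto
    moreover have "boundary (clique_complex (V - {v}) R) z = 0"
      using boundary_subset[OF zv sub V(1,2)] z(2) by simp
    ultimately obtain u where u: "u \<in> chains (clique_complex (V - {v}) R) (Suc (Suc m))"
      "z = boundary (clique_complex (V - {v}) R) u"
      using zv unfolding exact_at_def by blast
    have "u \<in> chains ?K (Suc (Suc m))" by (rule chains_clique_mono[OF u(1) sub])
    then have "u = 0" by (rule cocktail_party_chains_zero[OF V(1,3,4,5)])
    then show ?thesis using u(2) by (simp add: boundary_zero)
  qed
  ultimately show ?case by blast
qed

section \<open>The persistence diagram\<close>

lemma VR_eq_clique_complex:
  assumes "finite Y"
  shows "VR Y d r = clique_complex Y (\<lambda>x y. d x y \<le> r)"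
proof -
  have "diam d \<sigma> \<le> r \<longleftrightarrow> (\<forall>x\<in>\<sigma>. \<forall>y\<in>\<sigma>. d x y \<le> r)" if "\<sigma> \<noteq> {}" "\<sigma> \<subseteq> Y" for \<sigma>
  proof -
    have "{d x y |x y. x \<in> \<sigma> \<and> y \<in> \<sigma>} = (\<lambda>(x, y). d x y) ` (\<sigma> \<times> \<sigma>)" by auto
    moreover have "finite \<sigma>" using that(2) assms by (rule finite_subset)
    ultimately show ?thesis using that(1) by (auto simp: diam_def)
  qed
  then show ?thesis unfolding VR_def clique_complex_def by blast
qed

section \<open>Homology classes as cosets of the boundaries\<close>

lemma boundaries_coset:
  fixes z :: "'a list \<Rightarrow> 'f::field"
  assumes "z \<in> boundaries K k"
  shows "z +o boundaries K k = boundaries K k"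
proof -
  obtain w where w: "w \<in> chains K (k + 2)" "z = boundary K w"
    using assms by (auto simp: boundaries_def)
  have sum: "(\<lambda>ys. boundary K w ys + a * boundary K u ys) \<in> boundaries K k"
    if "u \<in> chains K (k + 2)" "w \<in> chains K (k + 2)" for u w :: "'a list \<Rightarrow> 'f" and a
    using imageI[OF chains_add[OF that(2) chains_scale[OF that(1), of a]], of "boundary K"]
    unfolding boundary_add boundary_scale boundaries_def .
  show ?thesis
  proof
    show "z +o boundaries K k \<subseteq> boundaries K k"
      using sum[of _ w 1] w by (auto simp: elt_set_plus_def boundaries_def plus_fun_def)
    show "boundaries K k \<subseteq> z +o boundaries K k"
    proof
      fix y :: "'a list \<Rightarrow> 'f" assume "y \<in> boundaries K k"
      then obtain u where u: "u \<in> chains K (k + 2)" "y = boundary K u"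
        by (auto simp: boundaries_def)
      have "y = z + (\<lambda>ys. boundary K u ys + (-1) * boundary K w ys)"
        by (simp add: u w plus_fun_def)
      then show "y \<in> z +o boundaries K k"
        using sum[OF w(1) u(1), of "-1"] unfolding elt_set_plus_def by blast
    qed
  qed
qed

lemma zero_in_cycles: "0 \<in> cycles K k"
  by (simp add: cycles_def chains_zero boundary_zero)

lemma cycles_add: "y \<in> cycles K k \<Longrightarrow> z \<in> cycles K k \<Longrightarrow> (\<lambda>xs. y xs + z xs) \<in> cycles K k"
  by (auto simp: cycles_def boundary_add zero_fun_def intro: chains_add)

lemma cycles_scale: "z \<in> cycles K k \<Longrightarrow> (\<lambda>xs. a * z xs) \<in> cycles K k"
  by (auto simp: cycles_def boundary_scale zero_fun_def intro: chains_scale)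

lemma VR_homology_trivial:
  assumes "exact_at TYPE('f::field) (VR Y d r) (Suc k)"
  shows "space_at (VR_homology k Y d :: ('f, ('a list \<Rightarrow> 'f) set) persistence_module) r =
    {boundaries (VR Y d r) k}"
proof -
  let ?K = "VR Y d r"
  have "z \<in> boundaries ?K k" if "z \<in> cycles ?K k" for z :: "'a list \<Rightarrow> 'f"
    using assms that by (auto simp: exact_at_def cycles_def boundaries_def)
  then have "z +o boundaries ?K k = boundaries ?K k" if "z \<in> cycles ?K k" for z :: "'a list \<Rightarrow> 'f"
    using that boundaries_coset by blast
  then show ?thesis
    using zero_in_cycles[of ?K k] by (auto simp: VR_homology_def)
qed

lemma VR_homology_cycles:
  assumes "boundaries (VR Y d r) k = {0 :: 'a list \<Rightarrow> 'f::field}"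
  shows "space_at (VR_homology k Y d :: ('f, ('a list \<Rightarrow> 'f) set) persistence_module) r =
    {{z} | z. z \<in> cycles (VR Y d r) k}"
  by (auto simp: VR_homology_def assms elt_set_plus_def)

text \<open>By \<open>interval\<close>, the complex is a cross-polytope boundary exactly for
  \<open>r\<close> in \<open>[b, e)\<close>. Elsewhere the homology is zero. Inside, the complex is
  constant without simplices on \<open>k + 2\<close> vertices, so the homology is the line of cycles
  and its coordinate gives the isomorphism.\<close>

lemma is_dgm_VR_one_interval:
  assumes Y: "finite Y" "card Y \<le> 2 * k + 2"
    and d: "\<And>x. x \<in> Y \<Longrightarrow> d x x = 0" "\<And>x y. x \<in> Y \<Longrightarrow> y \<in> Y \<Longrightarrow> d x y = d y x"
    and "0 \<le> b"
    and interval: "\<And>r. 0 \<le> r \<Longrightarrow>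
      b \<le> r \<and> r < e \<longleftrightarrow> card Y = 2 * k + 2 \<and> cocktail_party Y (\<lambda>x y. d x y \<le> r)"
  shows "is_dgm_VR TYPE('f::field) k Y d (if b < e then {#(b, e)#} else {#})"
proof -
  define M where "M = (VR_homology k Y d :: ('f, ('a list \<Rightarrow> 'f) set) persistence_module)"
  define D where "D = (if b < e then {#(b, e)#} else {#})"
  define alive where "alive r \<longleftrightarrow> b \<le> r \<and> r < e" for r
  let ?K = "VR Y d" and ?R = "\<lambda>r x y. d x y \<le> r"
  let ?B = "\<lambda>r. boundaries (?K r) k :: ('a list \<Rightarrow> 'f) set"
  have refl: "reflp_on Y (?R r)" if "0 \<le> r" for r using that d(1) by (auto simp: reflp_on_def)
  have sym: "symp_on Y (?R r)" for r using d(2) by (auto simp: symp_on_def)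
  have K: "?K r = clique_complex Y (?R r)" for r using Y(1) by (rule VR_eq_clique_complex)
  have alive_nonneg: "0 \<le> r" if "alive r" for r using that \<open>0 \<le> b\<close> by (simp add: alive_def)
  have aliveD: "card Y = 2 * Suc k" "cocktail_party Y (?R r)" if "alive r" for r
    using interval[of r] alive_nonneg[OF that] that by (auto simp: alive_def)
  have dead: "space_at M r = {?B r}" if "0 \<le> r" "\<not> alive r" for r
    unfolding M_def
  proof (rule VR_homology_trivial)
    have "\<not> (card Y = 2 * Suc k \<and> cocktail_party Y (?R r))"
      using interval[OF that(1)] that(2) by (auto simp: alive_def)
    then show "exact_at TYPE('f) (?K r) (Suc k)"
      unfolding K using Y refl[OF that(1)] sym by (intro exact_few_vertices) auto
  qed
  \<comment> \<open>A chain at \<open>r\<close> is also a chain at every later \<open>s\<close>, so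
    there are no simplices on \<open>k + 2\<close> vertices before the birth either.\<close>
  have top: "c = 0" if "alive s" "r \<le> s" "c \<in> chains (?K r) (k + 2)" for r s and c :: "'a list \<Rightarrow> 'f"
  proof -
    have "c \<in> chains (clique_complex Y (?R s)) (Suc (Suc k))"
      by (rule chains_clique_mono[of c Y "?R r"]) (use that K in auto)
    then show ?thesis
      by (rule cocktail_party_chains_zero[OF Y(1) sym aliveD(2)[OF that(1)] aliveD(1)[OF that(1)]])
  qed
  have B0: "?B r = {0}" if "alive s" "r \<le> s" for r s
  proof -
    have "chains (?K r) (k + 2) = {0 :: 'a list \<Rightarrow> 'f}"
      using top[OF that] chains_zero by blast
    then show ?thesis by (simp add: boundaries_def boundary_zero)
  qed
  \<comment> \<open>A distance in \<open>(b, r]\<close> makes \<open>y\<close> the antipode of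
    \<open>x\<close> at parameter \<open>b\<close>. The antipode of \<open>x\<close> at
    \<open>r\<close> is non-adjacent to \<open>x\<close> at \<open>b\<close> as well, so it is
    \<open>y\<close>, contradicting \<open>d x y \<le> r\<close>.\<close>
  have R_const: "d x y \<le> b" if r: "alive r" and xy: "x \<in> Y" "y \<in> Y" "d x y \<le> r" for r x y
  proof (rule ccontr)
    assume "\<not> d x y \<le> b"
    have "alive b" using r by (auto simp: alive_def)
    obtain y' where "y' \<in> Y" "\<not> d x y' \<le> r"
      using aliveD(2)[OF r] xy(1) unfolding cocktail_party_def by blast
    moreover have "b \<le> r" using r by (simp add: alive_def)
    ultimately have "y' = y"
      using aliveD(2)[OF \<open>alive b\<close>] xy(1,2) \<open>\<not> d x y \<le> b\<close> unfolding cocktail_party_def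
      by (metis order_trans)
    then show False using \<open>\<not> d x y' \<le> r\<close> xy(3) by simp
  qed
  have K_const: "?K r = ?K b" if "alive r" for r
  proof -
    have "d x y \<le> r \<longleftrightarrow> d x y \<le> b" if "x \<in> Y" "y \<in> Y" for x y
      using R_const[OF \<open>alive r\<close> that] \<open>alive r\<close> by (auto simp: alive_def)
    then show ?thesis unfolding K clique_complex_def by blast
  qed
  have live: "space_at M r = {{z} | z. z \<in> cycles (?K b) k}" if "alive r" for r
    using VR_homology_cycles[OF B0[OF that order_refl]] K_const[OF that] by (simp add: M_def)
  \<comment> \<open>The quantifier stands outside the implication so that a list \<open>xs\<close>
    is at hand for defining the isomorphism even when the interval is empty.\<close>
  have "\<exists>xs. alive b \<longrightarrow> (\<exists>z :: 'a list \<Rightarrow> 'f. z \<in> cycles (?K b) k \<and> z xs = 1) \<and>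
      (\<forall>z :: 'a list \<Rightarrow> 'f. z \<in> cycles (?K b) k \<longrightarrow> z xs = 0 \<longrightarrow> z = 0)"
  proof (cases "alive b")
    case True
    show ?thesis
      using cocktail_party_cycles[OF Y(1) refl sym aliveD(2)[OF True] aliveD(1)[OF True], where 'f = 'f] \<open>0 \<le> b\<close>
      unfolding cycles_def K by fastforce
  qed simp
  then obtain xs where xs: "alive b \<Longrightarrow> \<exists>z :: 'a list \<Rightarrow> 'f. z \<in> cycles (?K b) k \<and> z xs = 1"
    "\<And>z :: 'a list \<Rightarrow> 'f. alive b \<Longrightarrow> z \<in> cycles (?K b) k \<Longrightarrow> z xs = 0 \<Longrightarrow> z = 0"
    by blast
  have alive_b: "alive b" if "alive r" for r using that by (simp add: alive_def)
  \<comment> \<open>The only point \<open>(b, e)\<close> has multiplicity one, so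
    \<open>((b, e), 0)\<close> is the only index of a summand.\<close>
  define \<delta> :: "'f \<Rightarrow> (real \<times> real) \<times> nat \<Rightarrow> 'f" where "\<delta> a = (\<lambda>q. if q = ((b, e), 0) then a else 0)" for a
  \<comment> \<open>Inside the interval a class is a singleton \<open>{z}\<close> with coordinate
    \<open>z xs\<close>; at other parameters both spaces have one element.\<close>
  define \<phi> where "\<phi> r U = (if alive r then \<delta> (the_elem U xs) else \<delta> 0)" for r U
  have \<delta>0: "\<delta> 0 = 0" by (simp add: \<delta>_def zero_fun_def)
  have space_D: "space_at (interval_sum D) r = (if alive r then range \<delta> else {\<delta> 0})" for r
  proof -
    have "i < count D p \<and> r \<in> {fst p..<snd p} \<longleftrightarrow> (p, i) = ((b, e), 0) \<and> alive r" for p i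
      by (auto simp: D_def alive_def)
    then have *: "f \<in> space_at (interval_sum D) r \<longleftrightarrow> (\<forall>q. f q \<noteq> 0 \<longrightarrow> q = ((b, e), 0) \<and> alive r)"
      for f :: "(real \<times> real) \<times> nat \<Rightarrow> 'f"
      unfolding interval_sum_def persistence_module.select_convs mem_Collect_eq by (metis surj_pair)
    have "f = \<delta> (f ((b, e), 0))" if "f \<in> space_at (interval_sum D) r" for f
    proof
      fix q show "f q = \<delta> (f ((b, e), 0)) q"
        using that unfolding * \<delta>_def by (cases "q = ((b, e), 0)") (simp, metis)
    qed
    moreover have "f = \<delta> 0" if "f \<in> space_at (interval_sum D) r" "\<not> alive r" for f
      using that unfolding * \<delta>0 zero_fun_def by blast
    moreover have "\<delta> 0 \<in> space_at (interval_sum D) r" "alive r \<Longrightarrow> \<delta> a \<in> space_at (interval_sum D) r" for a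
      unfolding * by (auto simp: \<delta>_def)
    ultimately show ?thesis by (intro set_eqI iffI) (metis rangeI singletonI, metis (no_types) rangeE singletonD)
  qed
  have ops: "plus_at M r U W = U + W" "scale_at M r a U = (\<lambda>z xs. a * z xs) ` U + ?B r"
    "map_at M r s U = U + ?B s" for r s a U W
    by (simp_all add: M_def VR_homology_def)
  have ops_D: "plus_at (interval_sum D) r f g = f + g" "scale_at (interval_sum D) r a f = (\<lambda>x. a * f x)"
    for r a and f g :: "(real \<times> real) \<times> nat \<Rightarrow> 'f"
    by (simp_all add: interval_sum_def)
  have map_D: "map_at (interval_sum D) r s (\<delta> a) = (if alive s then \<delta> a else \<delta> 0)" for r s a
    by (auto simp: interval_sum_def \<delta>_def alive_def)
  have "bij_betw (\<phi> r) (space_at M r) (space_at (interval_sum D) r)" if "0 \<le> r" for r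
  proof (cases "alive r")
    case True
    show ?thesis
      unfolding bij_betw_def
    proof
      show "inj_on (\<phi> r) (space_at M r)"
      proof (rule inj_onI)
        fix U W assume "U \<in> space_at M r" "W \<in> space_at M r" and eq: "\<phi> r U = \<phi> r W"
        then obtain y z where U: "U = {y}" "W = {z}" and yz: "y \<in> cycles (?K b) k" "z \<in> cycles (?K b) k"
          unfolding live[OF True] by blast
        have "y xs = z xs" using fun_cong[OF eq, of "((b, e), 0)"] True by (simp add: \<phi>_def \<delta>_def U)
        then have "(\<lambda>xs. y xs + (-1) * z xs) = 0"
          by (intro xs(2)[OF alive_b[OF True] cycles_add[OF yz(1) cycles_scale[OF yz(2)]]]) simp
        then have "y xs = z xs" for xs by (simp add: fun_eq_iff)
        then show "U = W" using U by auto
      qed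
      show "\<phi> r ` space_at M r = space_at (interval_sum D) r"
      proof
        show "\<phi> r ` space_at M r \<subseteq> space_at (interval_sum D) r"
          using True by (auto simp: space_D \<phi>_def)
        obtain z :: "'a list \<Rightarrow> 'f" where z: "z \<in> cycles (?K b) k" "z xs = 1"
          using xs(1)[OF alive_b[OF True]] by blast
        have "\<delta> a = \<phi> r {\<lambda>xs. a * z xs}" for a using True z(2) by (simp add: \<phi>_def)
        moreover have "{\<lambda>xs. a * z xs} \<in> space_at M r" for a
          unfolding live[OF True] using cycles_scale[OF z(1)] by blast
        ultimately show "space_at (interval_sum D) r \<subseteq> \<phi> r ` space_at M r"
          using True by (auto simp: space_D)
      qed
    qed
  next
    case False
    then show ?thesis using dead[OF that] by (simp add: space_D \<phi>_def bij_betw_def)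
  qed
  moreover have "\<phi> r (plus_at M r U W) = plus_at (interval_sum D) r (\<phi> r U) (\<phi> r W)"
    if "U \<in> space_at M r" "W \<in> space_at M r" for r U W
  proof (cases "alive r")
    case True
    then show ?thesis using that live[OF True]
      by (auto simp: ops ops_D \<phi>_def \<delta>_def set_plus_def plus_fun_def)
  next
    case False
    then show ?thesis by (simp add: ops_D \<phi>_def \<delta>0)
  qed
  moreover have "\<phi> r (scale_at M r a U) = scale_at (interval_sum D) r a (\<phi> r U)"
    if "U \<in> space_at M r" for r a U
  proof (cases "alive r")
    case True
    then show ?thesis using that live[OF True] B0[OF True order_refl]
      by (auto simp: ops ops_D \<phi>_def \<delta>_def set_plus_def)
  next
    case False
    then show ?thesis by (simp add: ops_D \<phi>_def \<delta>_def)
  qed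
  moreover have "\<phi> s (map_at M r s U) = map_at (interval_sum D) r s (\<phi> r U)"
    if "0 \<le> r" "r \<le> s" "U \<in> space_at M r" for r s U
  proof (cases "alive s")
    case True
    \<comment> \<open>The boundaries at the earlier \<open>r\<close> vanish too, so a class from
      before the birth is the singleton \<open>{0}\<close>, which is sent to zero.\<close>
    have B: "?B r = {0}" "?B s = {0}" using B0[OF True] that(2) by auto
    show ?thesis
    proof (cases "alive r")
      case r: True
      then show ?thesis using that(3) live[OF r] True B(2)
        by (auto simp: ops map_D \<phi>_def set_plus_def)
    next
      case r: False
      then have "U = {0}" using that(3) dead[OF that(1) r] B(1) by simp
      then show ?thesis using r True B(2) by (simp add: ops map_D \<phi>_def set_plus_def)
    qed
  next
    case False
    then show ?thesis by (simp add: map_D \<phi>_def)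
  qed
  ultimately have "persistence_iso M (interval_sum D :: ('f, (real \<times> real) \<times> nat \<Rightarrow> 'f) persistence_module)"
    unfolding persistence_iso_def by (intro exI[of _ \<phi>]) blast
  moreover have "\<forall>(b, e)\<in>#D. 0 \<le> b \<and> b < e" using \<open>0 \<le> b\<close> by (simp add: D_def)
  ultimately show ?thesis by (simp add: is_dgm_VR_def M_def D_def)
qed

section \<open>Birth and death times from the rows of the distance matrix\<close>

text \<open>The two largest among \<open>f 0, \<dots>, f (m - 1)\<close> for nonnegative \<open>f\<close>, padded with zeros.\<close>

fun top_two :: "(nat \<Rightarrow> real) \<Rightarrow> nat \<Rightarrow> real \<times> real" where
  "top_two f 0 = (0, 0)"
| "top_two f (Suc j) = (let (a, b) = top_two f j in
     if a < f j then (f j, a) else if b < f j then (a, f j) else (a, b))"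

fun birth :: "(nat \<Rightarrow> nat \<Rightarrow> real) \<Rightarrow> nat \<Rightarrow> nat \<Rightarrow> real" where
  "birth f n 0 = 0"
| "birth f n (Suc i) = max (birth f n i) (snd (top_two (f i) n))"

text \<open>The value \<open>death f n 0\<close> is a dummy, the minimum over no rows.\<close>

fun death :: "(nat \<Rightarrow> nat \<Rightarrow> real) \<Rightarrow> nat \<Rightarrow> nat \<Rightarrow> real" where
  "death f n 0 = 0"
| "death f n (Suc i) = (if i = 0 then fst (top_two (f i) n) else min (death f n i) (fst (top_two (f i) n)))"

lemma top_two_bounds: "0 \<le> snd (top_two f m) \<and> snd (top_two f m) \<le> fst (top_two f m)"
  by (induction m) (auto simp: Let_def split: prod.splits)

text \<open>For \<open>r \<ge> 0\<close> the padding zeros never exceed \<open>r\<close>, so the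
  sign of the entries does not matter.\<close>

lemma less_fst_top_two:
  assumes "0 \<le> r"
  shows "r < fst (top_two f m) \<longleftrightarrow> (\<exists>j<m. r < f j)"
proof (induction m)
  case (Suc m)
  have "fst (top_two f (Suc m)) = max (fst (top_two f m)) (f m)"
    using top_two_bounds[of f m] by (auto simp: Let_def split: prod.splits)
  then show ?case using Suc by (auto simp: less_max_iff_disj less_Suc_eq)
qed (use assms in simp)

text \<open>A new entry \<open>x\<close> turns the two largest values \<open>a \<ge> b\<close> into
  the second largest value \<open>max b (min a x)\<close>. Equal values at different positions count
  separately.\<close>

lemma less_snd_top_two:
  assumes "0 \<le> r"
  shows "r < snd (top_two f m) \<longleftrightarrow> (\<exists>i<m. \<exists>j<i. r < f i \<and> r < f j)"
proof (induction m)
  case (Suc m)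
  have "snd (top_two f (Suc m)) = max (snd (top_two f m)) (min (fst (top_two f m)) (f m))"
    using top_two_bounds[of f m] by (auto simp: Let_def split: prod.splits)
  then show ?case using Suc less_fst_top_two[OF assms, of f m]
    by (auto simp: less_max_iff_disj less_Suc_eq)
qed (use assms in simp)

lemma birth_nonneg: "0 \<le> birth f n m"
  by (induction m) auto

lemma birth_le_iff:
  assumes "0 \<le> r"
  shows "birth f n m \<le> r \<longleftrightarrow> (\<forall>i<m. snd (top_two (f i) n) \<le> r)"
  using assms by (induction m) (auto simp: less_Suc_eq)

lemma less_death_iff:
  assumes "0 < m"
  shows "r < death f n m \<longleftrightarrow> (\<forall>i<m. r < fst (top_two (f i) n))"
  using assms
proof (induction m)
  case (Suc m)
  then show ?case by (cases "m = 0") (auto simp: less_Suc_eq)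
qed simp

text \<open>In one row, a second largest entry of at most \<open>r\<close> means at most one entry
  above \<open>r\<close>, and a largest entry above \<open>r\<close> means at least one. As
  \<open>0 < m\<close>, the dummy value of \<open>death\<close> is not met.\<close>

lemma birth_le_less_death_iff:
  assumes "0 \<le> r" "0 < m"
  shows "birth f n m \<le> r \<and> r < death f n m \<longleftrightarrow> (\<forall>i<m. \<exists>!j. j < n \<and> r < f i j)"
proof -
  have row: "(\<exists>!j. j < n \<and> r < g j) \<longleftrightarrow> snd (top_two g n) \<le> r \<and> r < fst (top_two g n)" for g
  proof -
    have "snd (top_two g n) \<le> r \<longleftrightarrow> (\<forall>i j. i < n \<longrightarrow> j < i \<longrightarrow> r < g i \<longrightarrow> \<not> r < g j)"
      using less_snd_top_two[OF assms(1), of g n] by (metis not_le)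
    also have "\<dots> \<longleftrightarrow> (\<forall>i j. i < n \<longrightarrow> j < n \<longrightarrow> r < g i \<longrightarrow> r < g j \<longrightarrow> i = j)"
      by (metis linorder_neqE_nat less_trans less_irrefl)
    finally show ?thesis
      unfolding less_fst_top_two[OF assms(1)] by blast
  qed
  show ?thesis
    unfolding birth_le_iff[OF assms(1)] less_death_iff[OF assms(2)] row by blast
qed

text \<open>Repeated points would give a row in which two distances exceed \<open>r\<close>.\<close>

lemma rows_iff_cocktail_party:
  fixes n :: nat
  assumes sym: "\<And>i j. i < n \<Longrightarrow> j < n \<Longrightarrow> d (x i) (x j) = (d (x j) (x i) :: real)"
  shows "(\<forall>i<n. \<exists>!j. j < n \<and> r < d (x i) (x j)) \<longleftrightarrow>
    card (x ` {..<n}) = n \<and> cocktail_party (x ` {..<n}) (\<lambda>u v. d u v \<le> r)"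
proof -
  have "inj_on x {..<n}" if rows: "\<forall>i<n. \<exists>!j. j < n \<and> r < d (x i) (x j)"
  proof (rule inj_onI)
    fix i i' assume i: "i \<in> {..<n}" "i' \<in> {..<n}" "x i = x i'"
    then obtain j where j: "j < n" "r < d (x i) (x j)" using rows by blast
    \<comment> \<open>By symmetry the entries \<open>i\<close> and \<open>i'\<close> of row
      \<open>j\<close> both exceed \<open>r\<close>, and uniqueness in that row identifies
      them.\<close>
    have "r < d (x j) (x i)" "r < d (x j) (x i')"
      using i j sym[of i j] by auto
    then show "i = i'" using rows i(1,2) j(1) by blast
  qed
  moreover have "card (x ` {..<n}) = n \<longleftrightarrow> inj_on x {..<n}"
    by (metis card_image card_lessThan eq_card_imp_inj_on finite_lessThan)
  moreover have "(\<forall>i<n. \<exists>!j. j < n \<and> r < d (x i) (x j)) \<longleftrightarrow>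
      cocktail_party (x ` {..<n}) (\<lambda>u v. d u v \<le> r)" if inj: "inj_on x {..<n}"
  proof -
    have "(\<exists>!j. j < n \<and> r < d (x i) (x j)) \<longleftrightarrow> (\<exists>!u. u \<in> x ` {..<n} \<and> \<not> d (x i) u \<le> r)" for i
    proof
      assume "\<exists>!j. j < n \<and> r < d (x i) (x j)"
      then obtain j where j: "j < n" "r < d (x i) (x j)"
        and uniq: "\<And>j'. j' < n \<Longrightarrow> r < d (x i) (x j') \<Longrightarrow> j' = j"
        by blast
      show "\<exists>!u. u \<in> x ` {..<n} \<and> \<not> d (x i) u \<le> r"
      proof (rule ex1I)
        show "x j \<in> x ` {..<n} \<and> \<not> d (x i) (x j) \<le> r" using j by simp
        show "u = x j" if "u \<in> x ` {..<n} \<and> \<not> d (x i) u \<le> r" for u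
          using that uniq by (metis imageE lessThan_iff not_le)
      qed
    next
      assume uniq: "\<exists>!u. u \<in> x ` {..<n} \<and> \<not> d (x i) u \<le> r"
      then obtain j where j: "j < n" "\<not> d (x i) (x j) \<le> r" by blast
      have "j' = j" if "j' < n" "\<not> d (x i) (x j') \<le> r" for j'
      proof -
        have "x j' = x j" using uniq j that by blast
        then show ?thesis using inj j(1) that(1) by (simp add: inj_on_def)
      qed
      then show "\<exists>!j. j < n \<and> r < d (x i) (x j)"
        using j unfolding not_le by blast
    qed
    then show ?thesis by (simp add: cocktail_party_def) (simp only: Ball_def lessThan_iff)
  qed
  ultimately show ?thesis by blast
qed

section \<open>The program and its running time\<close>

text \<open>Total correctness with a bound on the cost rather than its exact value, since the
  branches of a conditional differ in cost. The predicate \<open>Q\<close> allows nesting in the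
  rule for \<open>Seq\<close>, as in a weakest-precondition calculus.\<close>

definition reaches ::
    "(nat \<Rightarrow> nat \<Rightarrow> nat \<Rightarrow> real) \<Rightarrow> program \<Rightarrow> machine \<Rightarrow> nat \<Rightarrow> (machine \<Rightarrow> bool) \<Rightarrow> bool" where
  "reaches A P \<sigma> c Q \<longleftrightarrow> (\<exists>t \<tau>. exec A P \<sigma> t \<tau> \<and> t \<le> c \<and> Q \<tau>)"

lemma reaches_mono:
  "reaches A P \<sigma> c Q \<Longrightarrow> c \<le> c' \<Longrightarrow> (\<And>\<tau>. Q \<tau> \<Longrightarrow> Q' \<tau>) \<Longrightarrow> reaches A P \<sigma> c' Q'"
  unfolding reaches_def by (meson order_trans)

lemma reaches_Skip: "Q \<sigma> \<Longrightarrow> reaches A Skip \<sigma> 1 Q"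
  unfolding reaches_def using exec.Skip by blast

lemma reaches_SetIndex:
  "Q (\<sigma>\<lparr>index := (index \<sigma>)(i := eval_index e \<sigma>)\<rparr>) \<Longrightarrow> reaches A (SetIndex i e) \<sigma> 1 Q"
  unfolding reaches_def using exec.SetIndex by blast

lemma reaches_LookUp:
  "Q (\<sigma>\<lparr>dist_reg := (dist_reg \<sigma>)(v := A (eval_index s \<sigma>) (eval_index i \<sigma>) (eval_index j \<sigma>))\<rparr>) \<Longrightarrow>
    reaches A (LookUp v s i j) \<sigma> 1 Q"
  unfolding reaches_def using exec.LookUp by blast

lemma reaches_Copy:
  "Q (\<sigma>\<lparr>dist_reg := (dist_reg \<sigma>)(u := dist_reg \<sigma> v)\<rparr>) \<Longrightarrow> reaches A (Copy u v) \<sigma> 1 Q"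
  unfolding reaches_def using exec.Copy by blast

lemma reaches_Emit:
  "Q (\<sigma>\<lparr>diagrams := (diagrams \<sigma>)(eval_index s \<sigma> :=
      add_mset (dist_reg \<sigma> u, dist_reg \<sigma> v) (diagrams \<sigma> (eval_index s \<sigma>)))\<rparr>) \<Longrightarrow>
    reaches A (Emit s u v) \<sigma> 1 Q"
  unfolding reaches_def using exec.Emit by blast

lemma reaches_Seq:
  "reaches A P \<sigma> c (\<lambda>\<tau>. reaches A P' \<tau> c' Q) \<Longrightarrow> reaches A (Seq P P') \<sigma> (c + c') Q"
  unfolding reaches_def by (meson exec.Seq add_mono)

lemma reaches_Cond:
  assumes "eval_test b \<sigma> \<Longrightarrow> reaches A P \<sigma> c Q" "\<not> eval_test b \<sigma> \<Longrightarrow> reaches A P' \<sigma> c' Q"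
  shows "reaches A (Cond b P P') \<sigma> (1 + max c c') Q"
proof (cases "eval_test b \<sigma>")
  case True
  then obtain t \<tau> where "exec A P \<sigma> t \<tau>" "t \<le> c" "Q \<tau>" using assms(1) by (auto simp: reaches_def)
  then show ?thesis using exec.Cond_True[OF True] unfolding reaches_def
    by (intro exI[of _ "1 + t"] exI[of _ \<tau>]) auto
next
  case False
  then obtain t \<tau> where "exec A P' \<sigma> t \<tau>" "t \<le> c'" "Q \<tau>" using assms(2) by (auto simp: reaches_def)
  then show ?thesis using exec.Cond_False[OF False] unfolding reaches_def
    by (intro exI[of _ "1 + t"] exI[of _ \<tau>]) auto
qed

text \<open>\<open>I j\<close> holds after \<open>j\<close> rounds. Each round costs
  \<open>c\<close> and one test; the failing last test gives the final \<open>+ 1\<close>.\<close>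

lemma reaches_Loop:
  assumes step: "\<And>j \<sigma>. j < m \<Longrightarrow> I j \<sigma> \<Longrightarrow> eval_test b \<sigma> \<and> reaches A P \<sigma> c (I (Suc j))"
    and final: "\<And>\<sigma>. I m \<sigma> \<Longrightarrow> \<not> eval_test b \<sigma>"
    and "I 0 \<sigma>"
  shows "reaches A (Loop b P) \<sigma> (m * (c + 1) + 1) (I m)"
proof -
  have "reaches A (Loop b P) \<sigma> (l * (c + 1) + 1) (I m)" if "I j \<sigma>" "j + l = m" for j l \<sigma>
    using that
  proof (induction l arbitrary: j \<sigma>)
    case 0
    then show ?case
      using exec.Loop_False[OF final] unfolding reaches_def by fastforce
  next
    case (Suc l)
    have b: "eval_test b \<sigma>" and P: "reaches A P \<sigma> c (I (Suc j))" using step[of j \<sigma>] Suc.prems by auto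
    obtain t \<sigma>' where t: "exec A P \<sigma> t \<sigma>'" "t \<le> c" "I (Suc j) \<sigma>'" using P by (auto simp: reaches_def)
    obtain t' \<tau> where t': "exec A (Loop b P) \<sigma>' t' \<tau>" "t' \<le> l * (c + 1) + 1" "I m \<tau>"
      using Suc.IH[OF t(3)] Suc.prems(2) by (auto simp: reaches_def)
    show ?case
      using exec.Loop_True[OF b t(1) t'(1)] t(2) t'(2,3) unfolding reaches_def
      by (intro exI[of _ "1 + t + t'"] exI[of _ \<tau>]) auto
  qed
  from this[of 0 \<sigma> m] show ?thesis using \<open>I 0 \<sigma>\<close> by simp
qed

text \<open>
  Index registers 2, 3, 4 hold the sample, row and column.  Distance register 0 stays zero, 1 and 2
  hold the two largest entries of the current row, 3 and 4 the birth and death times, 5 the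
  current entry.
\<close>

definition scan_entry :: program where
  "scan_entry =
    Seq (LookUp 5 (Reg 2) (Reg 3) (Reg 4))
    (Seq (Cond (DistLess 1 5) (Seq (Copy 2 1) (Copy 1 5)) (Cond (DistLess 2 5) (Copy 2 5) Skip))
    (SetIndex 4 (Add (Reg 4) (Num 1))))"

text \<open>The minimum over the rows has no neutral starting value among the distances at hand, so
  the first row, recognised by \<open>IndexLess (Reg 3) (Num 1)\<close>, initialises register
  4.\<close>

definition scan_row :: program where
  "scan_row =
    Seq (Copy 1 0)
    (Seq (Copy 2 0)
    (Seq (SetIndex 4 (Num 0))
    (Seq (Loop (IndexLess (Reg 4) (Reg 0)) scan_entry)
    (Seq (Cond (DistLess 3 2) (Copy 3 2) Skip)
    (Seq (Cond (IndexLess (Reg 3) (Num 1)) (Copy 4 1) (Cond (DistLess 1 4) (Copy 4 1) Skip))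
    (SetIndex 3 (Add (Reg 3) (Num 1))))))))"

definition scan_sample :: program where
  "scan_sample =
    Seq (Copy 3 0)
    (Seq (SetIndex 3 (Num 0))
    (Seq (Loop (IndexLess (Reg 3) (Reg 0)) scan_row)
    (Seq (Cond (DistLess 3 4) (Emit (Reg 2) 3 4) Skip)
    (SetIndex 2 (Add (Reg 2) (Num 1))))))"

definition scan_samples :: program where
  "scan_samples = Loop (IndexLess (Reg 2) (Reg 1)) scan_sample"

section \<open>Loop invariants and operation counts\<close>

definition at_sample :: "nat \<Rightarrow> nat \<Rightarrow> nat \<Rightarrow> (nat \<Rightarrow> (real \<times> real) multiset) \<Rightarrow> machine \<Rightarrow> bool" where
  "at_sample n N s D \<sigma> \<longleftrightarrow> index \<sigma> 0 = n \<and> index \<sigma> 1 = N \<and> index \<sigma> 2 = s \<and> dist_reg \<sigma> 0 = 0 \<and> diagrams \<sigma> = D"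

definition at_row ::
    "nat \<Rightarrow> nat \<Rightarrow> nat \<Rightarrow> (nat \<Rightarrow> (real \<times> real) multiset) \<Rightarrow> nat \<Rightarrow> real \<Rightarrow> real \<Rightarrow> machine \<Rightarrow> bool" where
  "at_row n N s D i b e \<sigma> \<longleftrightarrow> at_sample n N s D \<sigma> \<and> index \<sigma> 3 = i \<and> dist_reg \<sigma> 3 = b \<and> dist_reg \<sigma> 4 = e"

definition at_entry ::
    "(nat \<Rightarrow> nat \<Rightarrow> nat \<Rightarrow> real) \<Rightarrow> nat \<Rightarrow> nat \<Rightarrow> nat \<Rightarrow> (nat \<Rightarrow> (real \<times> real) multiset) \<Rightarrow>
      nat \<Rightarrow> real \<Rightarrow> real \<Rightarrow> nat \<Rightarrow> machine \<Rightarrow> bool" where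
  "at_entry A n N s D i b e j \<sigma> \<longleftrightarrow> at_row n N s D i b e \<sigma> \<and> index \<sigma> 4 = j \<and>
     dist_reg \<sigma> 1 = fst (top_two (A s i) j) \<and> dist_reg \<sigma> 2 = snd (top_two (A s i) j)"

lemmas reaches_rules = reaches_Skip reaches_SetIndex reaches_LookUp reaches_Copy reaches_Emit
  reaches_Seq reaches_Cond

lemma reaches_scan_entry:
  assumes "at_entry A n N s D i b e j \<sigma>"
  shows "reaches A scan_entry \<sigma> 5 (at_entry A n N s D i b e (Suc j))"
proof -
  have "reaches A scan_entry \<sigma> (1 + ((1 + max (1 + 1) (1 + max 1 1)) + 1))
      (at_entry A n N s D i b e (Suc j))"
    unfolding scan_entry_def
    using assms by (intro reaches_rules)
      (auto simp: at_entry_def at_row_def at_sample_def Let_def split: prod.splits)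
  then show ?thesis by (rule reaches_mono) auto
qed

lemma reaches_scan_row:
  assumes "at_row n N s D i b e \<sigma>"
  shows "reaches A scan_row \<sigma> (6 * n + 10) (at_row n N s D (Suc i) (max b (snd (top_two (A s i) n)))
    (if i = 0 then fst (top_two (A s i) n) else min e (fst (top_two (A s i) n))))"
    (is "reaches A scan_row \<sigma> _ ?Q")
proof -
  have loop: "reaches A (Loop (IndexLess (Reg 4) (Reg 0)) scan_entry) \<tau> (n * (5 + 1) + 1)
      (at_entry A n N s D i b e n)" if "at_entry A n N s D i b e 0 \<tau>" for \<tau>
    by (rule reaches_Loop[where I = "at_entry A n N s D i b e"])
      (use that reaches_scan_entry in \<open>auto simp: at_entry_def at_row_def at_sample_def\<close>)
  have rest: "reaches A (Seq (Cond (DistLess 3 2) (Copy 3 2) Skip)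
    (Seq (Cond (IndexLess (Reg 3) (Num 1)) (Copy 4 1) (Cond (DistLess 1 4) (Copy 4 1) Skip))
    (SetIndex 3 (Add (Reg 3) (Num 1))))) \<tau> ((1 + max 1 1) + ((1 + max 1 (1 + max 1 1)) + 1)) ?Q"
    if "at_entry A n N s D i b e n \<tau>" for \<tau>
    using that by (intro reaches_rules)
      (auto simp: at_entry_def at_row_def at_sample_def)
  \<comment> \<open>Three initialisations, \<open>6 * n + 1\<close> for the loop, then at most 2, 3
    and 1 operations.\<close>
  have "reaches A scan_row \<sigma> (1 + (1 + (1 + ((n * (5 + 1) + 1) +
      ((1 + max 1 1) + ((1 + max 1 (1 + max 1 1)) + 1)))))) ?Q"
    unfolding scan_row_def
    by (intro reaches_Seq reaches_Copy reaches_SetIndex reaches_mono[OF loop order_refl rest])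
      (use assms in \<open>auto simp: at_entry_def at_row_def at_sample_def\<close>)
  then show ?thesis by (rule reaches_mono) auto
qed

definition diagram :: "(nat \<Rightarrow> nat \<Rightarrow> real) \<Rightarrow> nat \<Rightarrow> (real \<times> real) multiset" where
  "diagram f n = (if birth f n n < death f n n then {#(birth f n n, death f n n)#} else {#})"

lemma reaches_scan_sample:
  assumes \<sigma>: "at_sample n N s D \<sigma>" and "0 < n"
  shows "reaches A scan_sample \<sigma> (25 * n\<^sup>2) (at_sample n N (Suc s) (D(s := D s + diagram (A s) n)))"
    (is "reaches A scan_sample \<sigma> _ ?Q")
proof -
  \<comment> \<open>Before the first row register 4 holds a leftover value, so \<open>e\<close> is
    constrained only for \<open>i > 0\<close>.\<close>
  define I where "I i \<tau> \<longleftrightarrow> (\<exists>e. at_row n N s D i (birth (A s) n i) e \<tau> \<and> (0 < i \<longrightarrow> e = death (A s) n i))"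
    for i \<tau>
  have step: "reaches A scan_row \<tau> (6 * n + 10) (I (Suc i))" if "I i \<tau>" for i \<tau>
  proof -
    obtain e where e: "at_row n N s D i (birth (A s) n i) e \<tau>" "0 < i \<longrightarrow> e = death (A s) n i"
      using \<open>I i \<tau>\<close> by (auto simp: I_def)
    show ?thesis
      by (rule reaches_mono[OF reaches_scan_row[OF e(1)] order_refl]) (use e(2) in \<open>auto simp: I_def\<close>)
  qed
  have loop: "reaches A (Loop (IndexLess (Reg 3) (Reg 0)) scan_row) \<tau> (n * (6 * n + 10 + 1) + 1) (I n)"
    if "I 0 \<tau>" for \<tau>
    by (rule reaches_Loop[where I = I])
      (use that step in \<open>auto simp: I_def at_row_def at_sample_def\<close>)
  have rest: "reaches A (Seq (Cond (DistLess 3 4) (Emit (Reg 2) 3 4) Skip)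
    (SetIndex 2 (Add (Reg 2) (Num 1)))) \<tau> ((1 + max 1 1) + 1) ?Q" if "I n \<tau>" for \<tau>
    using that \<open>0 < n\<close> by (intro reaches_rules)
      (auto simp: I_def at_row_def at_sample_def diagram_def)
  have "reaches A scan_sample \<sigma> (1 + (1 + ((n * (6 * n + 10 + 1) + 1) + ((1 + max 1 1) + 1)))) ?Q"
    unfolding scan_sample_def
    by (intro reaches_Seq reaches_Copy reaches_SetIndex reaches_mono[OF loop order_refl rest])
      (use \<sigma> in \<open>auto simp: I_def at_row_def at_sample_def\<close>)
  moreover have "1 + (1 + ((n * (6 * n + 10 + 1) + 1) + ((1 + max 1 1) + 1))) \<le> 25 * n\<^sup>2"
  proof -
    have "1 \<le> n * n" "n \<le> n * n" using \<open>0 < n\<close> by auto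
    moreover have "1 + (1 + ((n * (6 * n + 10 + 1) + 1) + ((1 + max 1 1) + 1))) = 6 * (n * n) + 11 * n + 6"
      by (simp add: algebra_simps)
    ultimately show ?thesis unfolding power2_eq_square by linarith
  qed
  ultimately show ?thesis by (rule reaches_mono)
qed

lemma reaches_scan_samples:
  assumes "0 < n" "0 < N"
  shows "reaches A scan_samples (start n N) (27 * (n\<^sup>2 * N))
    (\<lambda>\<tau>. \<forall>s<N. diagrams \<tau> s = diagram (A s) n)"
proof -
  let ?I = "\<lambda>s. at_sample n N s (\<lambda>s'. if s' < s then diagram (A s') n else {#})"
  have upd: "(\<lambda>s'. if s' < s then diagram (A s') n else {#})
      (s := (if s < s then diagram (A s) n else {#}) + diagram (A s) n) =
    (\<lambda>s'. if s' < Suc s then diagram (A s') n else {#})" for s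
    by (auto simp: fun_eq_iff less_Suc_eq)
  have "reaches A scan_samples (start n N) (N * (25 * n\<^sup>2 + 1) + 1) (?I N)"
    unfolding scan_samples_def
  proof (rule reaches_Loop[where I = ?I])
    show "eval_test (IndexLess (Reg 2) (Reg 1)) \<sigma> \<and> reaches A scan_sample \<sigma> (25 * n\<^sup>2) (?I (Suc s))"
      if "s < N" "?I s \<sigma>" for s \<sigma>
      using reaches_scan_sample[OF that(2) assms(1), of A] that unfolding upd
      by (simp add: at_sample_def)
  qed (auto simp: at_sample_def start_def)
  \<comment> \<open>The \<open>N\<close> successful tests and the failing one are each absorbed by a
    further copy of \<open>n\<^sup>2 * N\<close>, as \<open>n\<close> and \<open>N\<close> are
    positive.\<close>
  moreover have "N * (25 * n\<^sup>2 + 1) + 1 \<le> 27 * (n\<^sup>2 * N)"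
  proof -
    have "N \<le> n\<^sup>2 * N" using assms(1) by simp
    moreover have "N * (25 * n\<^sup>2 + 1) + 1 = 25 * (n\<^sup>2 * N) + N + 1" by (simp add: algebra_simps)
    ultimately show ?thesis using assms(2) by linarith
  qed
  ultimately show ?thesis by (rule reaches_mono) (simp add: at_sample_def)
qed

theorem corollary4p9:
  "\<exists>(P :: program) (C :: nat). \<forall>(X :: 'a set) (d :: 'a \<Rightarrow> 'a \<Rightarrow> real) (k :: nat) (n :: nat) (N :: nat)
      (x :: nat \<Rightarrow> nat \<Rightarrow> 'a).
     Metric_space X d \<longrightarrow> n = 2 * k + 2 \<longrightarrow> N \<ge> 1 \<longrightarrow> (\<forall>s<N. \<forall>i<n. x s i \<in> X) \<longrightarrow>
     (\<exists>t \<tau>. exec (\<lambda>s i j. d (x s i) (x s j)) P (start n N) t \<tau> \<and>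
        t \<le> C * (n\<^sup>2 * N) \<and>
        (\<forall>s<N. is_dgm_VR TYPE('f::field) k (x s ` {..<n}) d (diagrams \<tau> s) \<and>
               diagrams \<tau> s \<in> principal_persistence_set TYPE('f) k X d))"
proof (rule exI[of _ scan_samples], rule exI[of _ 27], intro allI impI)
  fix X :: "'a set" and d :: "'a \<Rightarrow> 'a \<Rightarrow> real" and k n N :: nat and x :: "nat \<Rightarrow> nat \<Rightarrow> 'a"
  assume X: "Metric_space X d" and n: "n = 2 * k + 2" and N: "N \<ge> 1"
    and x: "\<forall>s<N. \<forall>i<n. x s i \<in> X"
  let ?A = "\<lambda>s i j. d (x s i) (x s j)"
  obtain t \<tau> where run: "exec ?A scan_samples (start n N) t \<tau>" "t \<le> 27 * (n\<^sup>2 * N)"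
    "\<forall>s<N. diagrams \<tau> s = diagram (?A s) n"
    using reaches_scan_samples[of n N ?A] n N unfolding reaches_def by auto
  have "is_dgm_VR TYPE('f) k (x s ` {..<n}) d (diagrams \<tau> s) \<and>
      diagrams \<tau> s \<in> principal_persistence_set TYPE('f) k X d" if "s < N" for s
  proof
    let ?Y = "x s ` {..<n}" and ?b = "birth (?A s) n n" and ?e = "death (?A s) n n"
    have Y: "?Y \<subseteq> X" "finite ?Y" "card ?Y \<le> 2 * k + 2"
      using x that n card_image_le[of "{..<n}" "x s"] by auto
    have "is_dgm_VR TYPE('f) k ?Y d (if ?b < ?e then {#(?b, ?e)#} else {#})"
    proof (rule is_dgm_VR_one_interval[OF Y(2,3)])
      show "d u u = 0" if "u \<in> ?Y" for u
        using that Y(1) Metric_space.zero[OF X, of u u] by auto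
      show "d u v = d v u" if "u \<in> ?Y" "v \<in> ?Y" for u v
        by (rule Metric_space.commute[OF X])
      \<comment> \<open>The row criterion evaluated by the program is the cross-polytope criterion
        of the homology; if points repeat, both sides fail.\<close>
      show "?b \<le> r \<and> r < ?e \<longleftrightarrow> card ?Y = 2 * k + 2 \<and> cocktail_party ?Y (\<lambda>u v. d u v \<le> r)"
        if "0 \<le> r" for r
        using birth_le_less_death_iff[OF that, of n "?A s" n] n
          rows_iff_cocktail_party[of n d "x s" r] Metric_space.commute[OF X] by simp
    qed (rule birth_nonneg)
    then show "is_dgm_VR TYPE('f) k ?Y d (diagrams \<tau> s)"
      using run(3) that by (simp add: diagram_def)
    then show "diagrams \<tau> s \<in> principal_persistence_set TYPE('f) k X d"
      using Y unfolding principal_persistence_set_def persistence_set_def by blast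
  qed
  then show "\<exists>t \<tau>. exec ?A scan_samples (start n N) t \<tau> \<and> t \<le> 27 * (n\<^sup>2 * N) \<and>
      (\<forall>s<N. is_dgm_VR TYPE('f) k (x s ` {..<n}) d (diagrams \<tau> s) \<and>
        diagrams \<tau> s \<in> principal_persistence_set TYPE('f) k X d)"
    using run by blast
qed

end
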